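(* Let $G$ be a finitely generated, non-elementary group and let $\mathcal{X}$ be a quasi-convex $G$-space. If $G$ contains a strongly contracting element (with respect to $G\curvearrowright\mathcal{X}$), then $G\curvearrowright\mathcal{X}$ is a growth tight action.
   Context: A group is elementary if it has a finite index cyclic subgroup. A $G$-space is a proper, geodesic metric space $(\mathcal{X},d)$ with a properly discontinuous, isometric action of $G$. A subset $\mathcal{A}\subset\mathcal{X}$ is $C$-quasi-convex if for all $a_0,a_1\in\mathcal{A}$ there exists a geodesic between $a_0$ and $a_1$ contained in the closed $C$-neighborhood of $\mathcal{A}$. A $G$-space is quasi-convex if it contains a $G$-orbit that is $C$-quasi-convex for some $C\geqslant 0$. Fix a basepoint $o\in\mathcal{X}$. Growth: $\delta_G:=\limsup_{r\to\infty}\frac1r\log\#\{g\in G\mid d(o,g.o)\leqslant r\}$. For a normal subgroup $\Gamma$, let $\bar d(g\Gamma,g'\Gamma):=\inf_{\gamma,\gamma'\in\Gamma}d(g\gamma.o,g'\gamma'.o)$ and $\delta_{G/\Gamma}:=\limsup_{r\to\infty}\frac1r\log\#\{g\Gamma\in G/\Gamma\mid \bar d(\Gamma,g\Gamma)\leqslant r\}$. These do not depend on $o$. The action $G\curvearrowright\mathcal{X}$ is growth tight if $\delta_G>\delta_{G/\Gamma}$ for every infinite normal subgroup $\Gamma$ of $G$. Strongly contracting: a coarse map $\pi\colon\mathcal{X}\to\mathcal{A}$, $\mathcal{A}\subset\mathcal{X}$, assigns to each point a (nonempty) subset of $\mathcal{A}$ of uniformly bounded diameter. It is strongly contracting if there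 is $C\geqslant 0$ such that: for $a\in\mathcal{A}$, $\pi(a)$ and $\{a\}$ are contained in the closed $C$-neighborhoods of each other; $d(x_0,x_1)<d(x_0,\mathcal{A})-C$ implies $\operatorname{diam}(\pi(x_0)\cup\pi(x_1))\leqslant C$ for all $x_0,x_1\in\mathcal{X}$; and $d(x,\pi(x))-d(x,\mathcal{A})\leqslant C$ for all $x\in\mathcal{X}$. An element $h\in G$ is strongly contracting if $i\mapsto h^i.o$ ($i\in\mathbb{Z}$) is a quasi-geodesic (a quasi-isometric embedding) and there exist a subset $\mathcal{A}\subset\mathcal{X}$ on which $\langle h\rangle$ acts cocompactly and a strongly contracting coarse map $\pi\colon\mathcal{X}\to\mathcal{A}$. *)

theory Defs
  imports "HOL-Analysis.Analysis" "HOL-Algebra.Algebra"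
begin

section \<open>Groups\<close>

definition finitely_generated_group :: "('g, 'm) monoid_scheme \<Rightarrow> bool" where
  "finitely_generated_group G \<longleftrightarrow>
     group G \<and> (\<exists>S. finite S \<and> S \<subseteq> carrier G \<and> generate G S = carrier G)"

definition elementary_group :: "('g, 'm) monoid_scheme \<Rightarrow> bool" where
  "elementary_group G \<longleftrightarrow>
     (\<exists>H. subgroup H G \<and> cyclic_group (G\<lparr>carrier := H\<rparr>) \<and> finite (rcosets\<^bsub>G\<^esub> H))"


section \<open>\<open>G\<close>-spaces\<close>

text \<open>An action of \<open>G\<close> on the space \<open>'x\<close> is a map \<open>\<phi>\<close> with \<^term>\<open>group_action G UNIV \<phi>\<close>;
  \<open>\<phi> g x\<close> is \<open>g.x\<close>.\<close>

definition proper_space :: "'x::metric_space itself \<Rightarrow> bool" where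
  "proper_space _ \<longleftrightarrow> (\<forall>(x::'x) r. compact (cball x r))"

definition is_geodesic :: "(real \<Rightarrow> 'x::metric_space) \<Rightarrow> 'x \<Rightarrow> 'x \<Rightarrow> bool" where
  "is_geodesic c x y \<longleftrightarrow>
     c 0 = x \<and> c (dist x y) = y \<and>
     (\<forall>s\<in>{0..dist x y}. \<forall>t\<in>{0..dist x y}. dist (c s) (c t) = \<bar>s - t\<bar>)"

definition geodesic_space :: "'x::metric_space itself \<Rightarrow> bool" where
  "geodesic_space _ \<longleftrightarrow> (\<forall>x y::'x. \<exists>c. is_geodesic c x y)"

definition isometric_action ::
    "('g, 'm) monoid_scheme \<Rightarrow> ('g \<Rightarrow> 'x::metric_space \<Rightarrow> 'x) \<Rightarrow> bool" where
  "isometric_action G \<phi> \<longleftrightarrow>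
     group_action G UNIV \<phi> \<and> (\<forall>g\<in>carrier G. \<forall>x y. dist (\<phi> g x) (\<phi> g y) = dist x y)"

definition properly_discontinuous ::
    "('g, 'm) monoid_scheme \<Rightarrow> ('g \<Rightarrow> 'x::metric_space \<Rightarrow> 'x) \<Rightarrow> bool" where
  "properly_discontinuous G \<phi> \<longleftrightarrow>
     (\<forall>K. compact K \<longrightarrow> finite {g \<in> carrier G. \<phi> g ` K \<inter> K \<noteq> {}})"

definition G_space ::
    "('g, 'm) monoid_scheme \<Rightarrow> ('g \<Rightarrow> 'x::metric_space \<Rightarrow> 'x) \<Rightarrow> bool" where
  "G_space G \<phi> \<longleftrightarrow>
     proper_space TYPE('x) \<and> geodesic_space TYPE('x) \<and>
     isometric_action G \<phi> \<and> properly_discontinuous G \<phi>"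

text \<open>Only meaningful for nonempty \<open>A\<close>, because \<^term>\<open>infdist x {} = 0\<close>.
  All uses below are for nonempty sets.\<close>

definition closed_nbhd :: "real \<Rightarrow> 'x::metric_space set \<Rightarrow> 'x set" where
  "closed_nbhd C A = {x. infdist x A \<le> C}"

definition quasi_convex_set :: "real \<Rightarrow> 'x::metric_space set \<Rightarrow> bool" where
  "quasi_convex_set C A \<longleftrightarrow>
     (\<forall>a\<^sub>0\<in>A. \<forall>a\<^sub>1\<in>A. \<exists>c. is_geodesic c a\<^sub>0 a\<^sub>1 \<and> c ` {0..dist a\<^sub>0 a\<^sub>1} \<subseteq> closed_nbhd C A)"

definition quasi_convex_G_space ::
    "('g, 'm) monoid_scheme \<Rightarrow> ('g \<Rightarrow> 'x::metric_space \<Rightarrow> 'x) \<Rightarrow> bool" where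
  "quasi_convex_G_space G \<phi> \<longleftrightarrow>
     G_space G \<phi> \<and> (\<exists>x. \<exists>C\<ge>0. quasi_convex_set C (orbit G \<phi> x))"


section \<open>Growth\<close>

text \<open>Here and below the basepoint is called \<open>p\<close>.\<close>

definition exponential_growth_rate :: "(real \<Rightarrow> nat) \<Rightarrow> ereal" where
  "exponential_growth_rate N = Limsup at_top (\<lambda>r. ereal (1 / r * ln (real (N r))))"

definition growth_exponent ::
    "('g, 'm) monoid_scheme \<Rightarrow> ('g \<Rightarrow> 'x::metric_space \<Rightarrow> 'x) \<Rightarrow> 'x \<Rightarrow> ereal" where
  "growth_exponent G \<phi> p =
     exponential_growth_rate (\<lambda>r. card {g \<in> carrier G. dist p (\<phi> g p) \<le> r})"

text \<open>For cosets \<open>U = g\<Gamma>\<close> and \<open>V = g'\<Gamma>\<close>, ranging over \<open>u \<in> U\<close> and \<open>v \<in> V\<close> is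
  ranging over \<open>g\<gamma>\<close> and \<open>g'\<gamma>'\<close> with \<open>\<gamma>, \<gamma>' \<in> \<Gamma>\<close>. In the library, \<^term>\<open>G Mod \<Gamma>\<close> consists
  of right cosets, which for normal \<open>\<Gamma>\<close> are the same sets as the left cosets.\<close>

definition coset_dist ::
    "('g \<Rightarrow> 'x::metric_space \<Rightarrow> 'x) \<Rightarrow> 'x \<Rightarrow> 'g set \<Rightarrow> 'g set \<Rightarrow> real" where
  "coset_dist \<phi> p U V = (INF (u, v)\<in>U \<times> V. dist (\<phi> u p) (\<phi> v p))"

definition quotient_growth_exponent ::
    "('g, 'm) monoid_scheme \<Rightarrow> ('g \<Rightarrow> 'x::metric_space \<Rightarrow> 'x) \<Rightarrow> 'x \<Rightarrow> 'g set \<Rightarrow> ereal" where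
  "quotient_growth_exponent G \<phi> p \<Gamma> =
     exponential_growth_rate (\<lambda>r. card {U \<in> carrier (G Mod \<Gamma>). coset_dist \<phi> p \<Gamma> U \<le> r})"

definition growth_tight ::
    "('g, 'm) monoid_scheme \<Rightarrow> ('g \<Rightarrow> 'x::metric_space \<Rightarrow> 'x) \<Rightarrow> 'x \<Rightarrow> bool" where
  "growth_tight G \<phi> p \<longleftrightarrow>
     (\<forall>\<Gamma>. normal \<Gamma> G \<and> infinite \<Gamma> \<longrightarrow>
        growth_exponent G \<phi> p > quotient_growth_exponent G \<phi> p \<Gamma>)"


section \<open>Strongly contracting elements\<close>

text \<open>The library's \<^const>\<open>diameter\<close> is only meaningful on bounded sets.\<close>

definition coarse_map :: "('x::metric_space \<Rightarrow> 'x set) \<Rightarrow> 'x set \<Rightarrow> bool" where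
  "coarse_map \<pi> A \<longleftrightarrow>
     (\<forall>x. \<pi> x \<noteq> {} \<and> \<pi> x \<subseteq> A) \<and> (\<exists>D. \<forall>x. bounded (\<pi> x) \<and> diameter (\<pi> x) \<le> D)"

definition strongly_contracting_map :: "('x::metric_space \<Rightarrow> 'x set) \<Rightarrow> 'x set \<Rightarrow> bool" where
  "strongly_contracting_map \<pi> A \<longleftrightarrow>
     coarse_map \<pi> A \<and>
     (\<exists>C\<ge>0.
        (\<forall>a\<in>A. \<pi> a \<subseteq> closed_nbhd C {a} \<and> {a} \<subseteq> closed_nbhd C (\<pi> a)) \<and>
        (\<forall>x\<^sub>0 x\<^sub>1. dist x\<^sub>0 x\<^sub>1 < infdist x\<^sub>0 A - C \<longrightarrow> diameter (\<pi> x\<^sub>0 \<union> \<pi> x\<^sub>1) \<le> C) \<and>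
        (\<forall>x. infdist x (\<pi> x) - infdist x A \<le> C))"

definition quasi_isometric_embedding_int :: "(int \<Rightarrow> 'x::metric_space) \<Rightarrow> bool" where
  "quasi_isometric_embedding_int f \<longleftrightarrow>
     (\<exists>K\<ge>1. \<exists>C\<ge>0. \<forall>i j.
        \<bar>real_of_int i - real_of_int j\<bar> / K - C \<le> dist (f i) (f j) \<and>
        dist (f i) (f j) \<le> K * \<bar>real_of_int i - real_of_int j\<bar> + C)"

definition acts_cocompactly_on ::
    "'g set \<Rightarrow> ('g \<Rightarrow> 'x::metric_space \<Rightarrow> 'x) \<Rightarrow> 'x set \<Rightarrow> bool" where
  "acts_cocompactly_on H \<phi> A \<longleftrightarrow>
     (\<forall>g\<in>H. \<phi> g ` A \<subseteq> A) \<and> (\<exists>K. compact K \<and> K \<subseteq> A \<and> A \<subseteq> (\<Union>g\<in>H. \<phi> g ` K))"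

definition strongly_contracting_element ::
    "('g, 'm) monoid_scheme \<Rightarrow> ('g \<Rightarrow> 'x::metric_space \<Rightarrow> 'x) \<Rightarrow> 'x \<Rightarrow> 'g \<Rightarrow> bool" where
  "strongly_contracting_element G \<phi> p h \<longleftrightarrow>
     h \<in> carrier G \<and>
     quasi_isometric_embedding_int (\<lambda>i. \<phi> (h [^]\<^bsub>G\<^esub> i) p) \<and>
     (\<exists>A \<pi>. acts_cocompactly_on (generate G {h}) \<phi> A \<and> strongly_contracting_map \<pi> A)"

end

(* Let h be the contracting element, A = {h^i p} its coarse axis, and |x| = d(p, x p). Strong
   contraction enters only through a reverse triangle inequality: if x, y have nearest points a, b on
   A which are far apart, then d(x,y) >= d(x,a) + d(a,b) + d(b,y) - D.

   An infinite normal subgroup Gamma of the non-elementary group G contains some g outside the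
   commensurator of <h>, and then gA and A have bounded projections to each other. Put
   f = h^N g h^-N, an element of Gamma. Choose in each coset of Gamma an almost shortest
   representative b; multiplying b by g or its inverse on either side makes its endpoints project to A
   near p. A geodesic from p to b_1 f b_2 f ... b_n f p then passes near the points b_1 p and b_1 f p.
   A geodesic from p to b p cannot pass in this way along a translate of the pair p, f p, since
   cancelling that copy of f would shorten b within its coset. Hence b_1 is determined up to boundedly
   many choices by the product, so the Poincare series of G diverges at every s for which the series
   of G/Gamma exceeds a suitable constant. Quasi-convexity makes the growth of G/Gamma
   submultiplicative, so its series tends to infinity at its exponent, and some s above the exponent
   qualifies. If G/Gamma is finite, the products g h^k_1 g h^k_2 ... show directly that G has
   positive growth. *)

theory Submission
  imports Defs
begin

text \<open>No freeness of the words is claimed. It is enough that the first letter of a product is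
  known up to \<open>M\<close> choices, where \<open>M\<close> depends on the inserted conjugate but
  not on the set of letters. Words of length n then have total weight at least
  \<open>(S / M) ^ n\<close>, so the sum \<open>S\<close> over the letters only has to exceed
  \<open>M\<close>. This is why divergence of the quotient series at its exponent matters, and why
  all constants are fixed before the finite set of letters. The obstacle is that errors could
  accumulate along a word. Passing through the transverse element resets the bound on the
  projection, whatever it was before, and a long letter then restores the bound assumed for the rest
  of the word. The conjugation by \<open>h [^] N\<close> makes cancellation profitable: a geodesic
  following both long powers can be shortened by about \<open>2 * len (h [^] N)\<close>, while the
  chosen representatives are within \<open>2 * len g\<close> of shortest.\<close>

section \<open>Projections to contracting sets\<close>

text \<open>Pointwise form of strong contraction: one positive constant, and distances to arbitrary
  points of \<open>\<pi> x\<close> in place of diameters and of the distance to the set.\<close>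

locale contracting_projection =
  fixes \<pi> :: "'x::metric_space \<Rightarrow> 'x set" and A :: "'x set" and C :: real
  assumes C_pos: "0 < C"
    and geodesic: "geodesic_space TYPE('x)"
    and proj_nonempty: "\<pi> x \<noteq> {}"
    and proj_subset: "\<pi> x \<subseteq> A"
    and proj_of_mem: "\<lbrakk>a \<in> A; c \<in> \<pi> a\<rbrakk> \<Longrightarrow> dist a c \<le> C"
    and proj_near: "c \<in> \<pi> x \<Longrightarrow> dist x c \<le> infdist x A + C"
    and proj_contracts:
      "\<lbrakk>dist x y < infdist x A - C; c \<in> \<pi> x; e \<in> \<pi> y\<rbrakk> \<Longrightarrow> dist c e \<le> C"
begin

text \<open>Distance \<open>4 * C\<close> from \<open>A\<close> allows steps of length
  \<open>2 * C\<close>, each moving the projection by at most \<open>C\<close>. So the projection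
  moves at half the speed of the path; this factor 1/2 is what the next lemma exploits.\<close>

lemma proj_along_far_path:
  assumes iso: "\<And>s t. \<lbrakk>s \<in> {0..L}; t \<in> {0..L}\<rbrakk> \<Longrightarrow> dist (\<alpha> s) (\<alpha> t) = \<bar>s - t\<bar>"
    and far: "\<And>t. t \<in> {0..L} \<Longrightarrow> 4 * C \<le> infdist (\<alpha> t) A"
    and st: "0 \<le> s" "s \<le> t" "t \<le> L"
    and c: "c \<in> \<pi> (\<alpha> s)" and e: "e \<in> \<pi> (\<alpha> t)"
  shows "dist c e \<le> (t - s) / 2 + 2 * C"
proof -
  have step: "dist c e \<le> real (Suc n) * C"
    if "t - s \<le> real n * (2 * C)" "0 \<le> s" "s \<le> t" "t \<le> L" "c \<in> \<pi> (\<alpha> s)" "e \<in> \<pi> (\<alpha> t)"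
    for n s t c e
    using that
  proof (induction n arbitrary: t e)
    case 0
    then have "dist (\<alpha> s) (\<alpha> t) < infdist (\<alpha> s) A - C"
      using iso[of s t] far[of s] C_pos by simp
    then show ?case
      using proj_contracts[of "\<alpha> s" "\<alpha> t" c e] 0 by simp
  next
    case (Suc n)
    define u where "u = max s (t - 2 * C)"
    obtain d where d: "d \<in> \<pi> (\<alpha> u)"
      using proj_nonempty by blast
    have u: "s \<le> u" "u \<le> t" "u - s \<le> real n * (2 * C)" "t - u \<le> 2 * C"
      using Suc.prems C_pos by (auto simp: u_def max_def algebra_simps)
    have "dist (\<alpha> u) (\<alpha> t) < infdist (\<alpha> u) A - C"
      using iso[of u t] far[of u] C_pos u Suc.prems by simp
    then have "dist d e \<le> C"
      using proj_contracts d Suc.prems by simp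
    moreover have "dist c d \<le> real (Suc n) * C"
      using Suc.IH[of u d] u Suc.prems d by simp
    ultimately show ?case
      using dist_triangle[of c e d] by (simp add: algebra_simps)
  qed
  define n where "n = nat \<lceil>(t - s) / (2 * C)\<rceil>"
  have nn: "0 \<le> (t - s) / (2 * C)"
    using st C_pos by simp
  then have "(t - s) / (2 * C) \<le> real n" and n_le: "real n \<le> (t - s) / (2 * C) + 1"
    unfolding n_def by linarith+
  then have "t - s \<le> real n * (2 * C)"
    using C_pos by (simp add: field_simps)
  from step[OF this st c e] have "dist c e \<le> real n * C + C"
    by (simp add: algebra_simps)
  also have "\<dots> \<le> ((t - s) / (2 * C) + 1) * C + C"
    using n_le C_pos by simp
  also have "\<dots> = (t - s) / 2 + 2 * C"
    using C_pos by (simp add: field_simps)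
  finally show ?thesis .
qed

text \<open>Near each end the projection is constant up to \<open>C\<close>. The middle part has
  length at most \<open>dist c e + 6 * C\<close>, because the detour through \<open>c\<close> and
  \<open>e\<close> is no shorter than the geodesic, and there the projection moves at half speed.
  Hence \<open>dist c e \<le> dist c e / 2 + 7 * C\<close>.\<close>

lemma proj_far_geodesic_bounded:
  assumes iso: "\<And>s t. \<lbrakk>s \<in> {0..L}; t \<in> {0..L}\<rbrakk> \<Longrightarrow> dist (\<alpha> s) (\<alpha> t) = \<bar>s - t\<bar>"
    and far: "\<And>t. t \<in> {0..L} \<Longrightarrow> 4 * C \<le> infdist (\<alpha> t) A"
    and L: "0 \<le> L" and c: "c \<in> \<pi> (\<alpha> 0)" and e: "e \<in> \<pi> (\<alpha> L)"
  shows "dist c e \<le> 14 * C"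
proof -
  define r where "r = infdist (\<alpha> 0) A"
  define s where "s = infdist (\<alpha> L) A"
  have r: "4 * C \<le> r" and s: "4 * C \<le> s"
    using far L by (auto simp: r_def s_def)
  have distL: "dist (\<alpha> 0) (\<alpha> L) = L"
    using iso[of 0 L] L by simp
  have from_start: "dist c d \<le> C" if "t \<in> {0..L}" "t < r - C" "d \<in> \<pi> (\<alpha> t)" for t d
    using proj_contracts[of "\<alpha> 0" "\<alpha> t" c d] that c iso[of 0 t] L by (simp add: r_def)
  have from_end: "dist e d \<le> C" if "t \<in> {0..L}" "L - t < s - C" "d \<in> \<pi> (\<alpha> t)" for t d
    using proj_contracts[of "\<alpha> L" "\<alpha> t" e d] that e iso[of L t] L by (simp add: s_def)
  show ?thesis
  proof (cases "L < (r - 2 * C) + (s - 2 * C)")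
    case True
    define t where "t = min L (r - 2 * C)"
    have t: "t \<in> {0..L}" "t < r - C" "L - t < s - C"
      using True r s C_pos L by (auto simp: t_def min_def)
    obtain d where "d \<in> \<pi> (\<alpha> t)"
      using proj_nonempty by blast
    then have "dist c d \<le> C" "dist e d \<le> C"
      using from_start from_end t by blast+
    then show ?thesis
      using dist_triangle2[of c e d] C_pos by simp
  next
    case False
    define u where "u = r - 2 * C"
    define v where "v = L - (s - 2 * C)"
    have uv: "u \<in> {0..L}" "v \<in> {0..L}" "u \<le> v" "u < r - C" "L - v < s - C"
      using False r s C_pos L by (auto simp: u_def v_def)
    obtain d d' where d: "d \<in> \<pi> (\<alpha> u)" "d' \<in> \<pi> (\<alpha> v)"
      using proj_nonempty by blast
    have "dist c d \<le> C" "dist e d' \<le> C"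
      using from_start from_end uv d by blast+
    moreover have "dist d d' \<le> (v - u) / 2 + 2 * C"
      using proj_along_far_path[OF iso far, of L u v d d'] uv d by auto
    moreover have "L \<le> r + s + 2 * C + dist c e"
      using proj_near[OF c] proj_near[OF e] distL dist_triangle[of "\<alpha> 0" "\<alpha> L" c]
        dist_triangle2[of c "\<alpha> L" e] by (simp add: r_def s_def)
    moreover have "dist c e \<le> dist c d + dist d d' + dist e d'"
      using dist_triangle[of c e d] dist_triangle2[of d e d'] by simp
    ultimately show ?thesis
      by (simp add: u_def v_def field_simps)
  qed
qed

text \<open>A geodesic with distant end projections must come within \<open>4 * C\<close> of
  \<open>A\<close>. Up to the first such point \<open>\<alpha> u\<close> the projection moves by at
  most \<open>14 * C\<close>, so \<open>\<alpha> u\<close> is within \<open>19 * C\<close> of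
  \<open>c\<close>, and the detour through \<open>c\<close> costs twice that.\<close>

lemma geodesic_passes_near_proj:
  assumes c: "c \<in> \<pi> x" and e: "e \<in> \<pi> y" and ce: "14 * C < dist c e"
  shows "dist x c + dist c y - 38 * C \<le> dist x y"
proof -
  obtain \<alpha> where "is_geodesic \<alpha> x y"
    using geodesic by (auto simp: geodesic_space_def)
  then have \<alpha>: "\<alpha> 0 = x" "\<alpha> (dist x y) = y"
    and iso: "\<And>s t. \<lbrakk>s \<in> {0..dist x y}; t \<in> {0..dist x y}\<rbrakk> \<Longrightarrow> dist (\<alpha> s) (\<alpha> t) = \<bar>s - t\<bar>"
    by (auto simp: is_geodesic_def)
  define S where "S = {t \<in> {0..dist x y}. infdist (\<alpha> t) A \<le> 4 * C}"
  have "S \<noteq> {}"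
  proof
    assume "S = {}"
    then have "4 * C \<le> infdist (\<alpha> t) A" if "t \<in> {0..dist x y}" for t
      using that by (force simp: S_def)
    from proj_far_geodesic_bounded[of "dist x y" \<alpha> c e] iso this c e ce \<alpha> show False
      by simp
  qed
  have bdd: "bdd_below S"
    by (rule bdd_belowI[of _ 0]) (simp add: S_def)
  define u where "u = Inf S"
  have lip: "infdist (\<alpha> s) A \<le> infdist (\<alpha> t) A + \<bar>s - t\<bar>"
    if "s \<in> {0..dist x y}" "t \<in> {0..dist x y}" for s t
    using infdist_triangle[of "\<alpha> s" A "\<alpha> t"] iso that by simp
  obtain s0 where s0: "s0 \<in> S"
    using \<open>S \<noteq> {}\<close> by blast
  have "0 \<le> u"
    unfolding u_def by (rule cInf_greatest[OF \<open>S \<noteq> {}\<close>]) (simp add: S_def)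
  moreover have "u \<le> s0"
    unfolding u_def using s0 bdd by (rule cInf_lower)
  ultimately have u: "u \<in> {0..dist x y}"
    using s0 by (auto simp: S_def)
  have u_le: "infdist (\<alpha> u) A \<le> 4 * C"
  proof (rule field_le_epsilon)
    fix \<epsilon> :: real assume "0 < \<epsilon>"
    then obtain s where s: "s \<in> S" "s < u + \<epsilon>"
      using cInf_lessD[OF \<open>S \<noteq> {}\<close>, of "u + \<epsilon>"] by (auto simp: u_def)
    have "u \<le> s"
      unfolding u_def using s(1) bdd by (rule cInf_lower)
    then show "infdist (\<alpha> u) A \<le> 4 * C + \<epsilon>"
      using lip[of u s] u s by (simp add: S_def)
  qed
  have before: "4 * C \<le> infdist (\<alpha> t) A" if "0 \<le> t" "t < u" for t
  proof (rule ccontr)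
    assume "\<not> ?thesis"
    then have "t \<in> S"
      using that u by (simp add: S_def)
    then show False
      using cInf_lower[OF _ bdd, of t] that by (simp add: u_def)
  qed
  obtain d where d: "d \<in> \<pi> (\<alpha> u)"
    using proj_nonempty by blast
  have near: "dist (\<alpha> u) c \<le> 19 * C"
  proof (cases "u = 0")
    case True
    then show ?thesis
      using u_le proj_near[OF c] \<alpha> C_pos by simp
  next
    case False
    have "4 * C \<le> infdist (\<alpha> u) A"
    proof (rule field_le_epsilon)
      fix \<epsilon> :: real assume \<epsilon>: "0 < \<epsilon>"
      define t where "t = max 0 (u - \<epsilon>)"
      have t: "t \<in> {0..dist x y}" "t < u" "\<bar>t - u\<bar> \<le> \<epsilon>"
        using u False \<epsilon> by (auto simp: t_def max_def)
      show "4 * C \<le> infdist (\<alpha> u) A + \<epsilon>"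
        using lip[OF t(1) u] before[of t] t by simp
    qed
    then have far: "4 * C \<le> infdist (\<alpha> t) A" if "t \<in> {0..u}" for t
      using before that by (cases "t = u") auto
    have "dist c d \<le> 14 * C"
      by (rule proj_far_geodesic_bounded[of u \<alpha>]) (use iso u far c d \<alpha> in auto)
    then show ?thesis
      using proj_near[OF d] u_le dist_triangle2[of "\<alpha> u" c d] by simp
  qed
  have "dist x (\<alpha> u) = u" "dist (\<alpha> u) y = dist x y - u"
    using iso[of 0 u] iso[of u "dist x y"] \<alpha> u by auto
  then show ?thesis
    using near dist_triangle[of x c "\<alpha> u"] dist_triangle[of c y "\<alpha> u"] by (simp add: dist_commute)
qed

text \<open>\<open>geodesic_passes_near_proj\<close> is used for \<open>x\<close>, \<open>y\<close>
  at \<open>c\<close> and for \<open>y\<close>, \<open>c\<close> at \<open>e\<close>. The point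
  \<open>c\<close> is within \<open>C\<close> of its own projection, whence \<open>15 * C\<close>
  instead of \<open>14 * C\<close>.\<close>

lemma proj_reverse_triangle:
  assumes c: "c \<in> \<pi> x" and e: "e \<in> \<pi> y" and ce: "15 * C < dist c e"
  shows "dist x c + dist c e + dist e y - 76 * C \<le> dist x y"
proof -
  obtain c' where c': "c' \<in> \<pi> c"
    using proj_nonempty by blast
  have "c \<in> A"
    using c proj_subset by blast
  with c' have "dist c c' \<le> C"
    by (rule proj_of_mem[rotated])
  then have "14 * C < dist e c'"
    using ce dist_triangle2[of c e c'] by (simp add: dist_commute)
  from geodesic_passes_near_proj[OF e c' this] geodesic_passes_near_proj[OF c e] ce C_pos
  show ?thesis
    by (simp add: dist_commute)
qed

end

lemma strongly_contracting_map_projection: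
  fixes A :: "'x::metric_space set"
  assumes geod: "geodesic_space TYPE('x)" and sc: "strongly_contracting_map \<pi> A"
  obtains C where "contracting_projection \<pi> A C"
proof -
  have ne: "\<pi> x \<noteq> {}" and sub: "\<pi> x \<subseteq> A" for x
    using sc by (auto simp: strongly_contracting_map_def coarse_map_def)
  obtain D where D: "\<And>x. bounded (\<pi> x)" "\<And>x. diameter (\<pi> x) \<le> D"
    using sc by (auto simp: strongly_contracting_map_def coarse_map_def)
  obtain C where C: "0 \<le> C" "\<And>a. a \<in> A \<Longrightarrow> \<pi> a \<subseteq> closed_nbhd C {a}"
    "\<And>x y. dist x y < infdist x A - C \<Longrightarrow> diameter (\<pi> x \<union> \<pi> y) \<le> C"
    "\<And>x. infdist x (\<pi> x) - infdist x A \<le> C"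
    using sc by (auto simp: strongly_contracting_map_def)
  have "D \<ge> 0"
    using D diameter_ge_0 order_trans by blast
  \<comment> \<open>\<open>D\<close> passes from an almost nearest point of \<open>\<pi> x\<close>
    to all its points; the 1 pays for an infimum that need not be attained.\<close>
  have near: "dist x c \<le> infdist x A + (C + D + 1)" if "c \<in> \<pi> x" for x c
  proof -
    obtain e where e: "e \<in> \<pi> x" "dist x e < infdist x (\<pi> x) + 1"
      using cInf_lessD[of "dist x ` \<pi> x" "infdist x (\<pi> x) + 1"] ne[of x]
      by (auto simp: infdist_notempty)
    have "dist e c \<le> D"
      using diameter_bounded_bound[OF D(1) e(1) that] D(2)[of x] by simp
    then show ?thesis
      using e dist_triangle[of x c e] C(4)[of x] by simp
  qed
  have "contracting_projection \<pi> A (C + D + 1)"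
  proof
    show "dist a c \<le> C + D + 1" if "a \<in> A" "c \<in> \<pi> a" for a c
      using near[OF that(2)] that(1) by simp
    show "dist c e \<le> C + D + 1"
      if "dist x y < infdist x A - (C + D + 1)" "c \<in> \<pi> x" "e \<in> \<pi> y" for x y c e
    proof -
      have "dist c e \<le> diameter (\<pi> x \<union> \<pi> y)"
        using D that by (intro diameter_bounded_bound) auto
      also have "\<dots> \<le> C"
        using that \<open>D \<ge> 0\<close> by (intro C(3)) simp
      finally show ?thesis
        using \<open>D \<ge> 0\<close> by simp
    qed
  qed (use C(1) \<open>D \<ge> 0\<close> geod ne sub near in auto)
  then show thesis
    by (rule that)
qed

section \<open>Isometric actions and orbit lengths\<close>

text \<open>Properness of the space and proper discontinuity enter only through
  \<open>finite_orbit_ball\<close>.\<close>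

locale isometry_group = group G for G (structure) +
  fixes \<phi> :: "'a \<Rightarrow> 'c::metric_space \<Rightarrow> 'c" and p :: 'c
  assumes act_mult: "\<lbrakk>g \<in> carrier G; k \<in> carrier G\<rbrakk> \<Longrightarrow> \<phi> (g \<otimes> k) x = \<phi> g (\<phi> k x)"
    and act_one [simp]: "\<phi> \<one> x = x"
    and act_isometry [simp]: "g \<in> carrier G \<Longrightarrow> dist (\<phi> g x) (\<phi> g y) = dist x y"
    and finite_orbit_ball: "finite {g \<in> carrier G. dist p (\<phi> g p) \<le> r}"
begin

definition len :: "'a \<Rightarrow> real" where
  "len g = dist p (\<phi> g p)"

lemma len_nonneg [simp]: "0 \<le> len g"
  by (simp add: len_def)

lemma len_one [simp]: "len \<one> = 0"
  by (simp add: len_def)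

lemma finite_len_le: "finite {g \<in> carrier G. len g \<le> r}"
  using finite_orbit_ball by (simp add: len_def)

lemma act_inv_act [simp]: "g \<in> carrier G \<Longrightarrow> \<phi> (inv g) (\<phi> g x) = x"
  using act_mult[of "inv g" g x] by simp

lemma dist_act_left: "g \<in> carrier G \<Longrightarrow> dist (\<phi> g x) y = dist x (\<phi> (inv g) y)"
  using act_isometry[of "inv g" "\<phi> g x" y] by simp

lemma dist_act_right: "g \<in> carrier G \<Longrightarrow> dist x (\<phi> g y) = dist (\<phi> (inv g) x) y"
  using dist_act_left[of "inv g" x y] by simp

lemma dist_orbit: "\<lbrakk>g \<in> carrier G; k \<in> carrier G\<rbrakk> \<Longrightarrow> dist (\<phi> g p) (\<phi> k p) = len (inv g \<otimes> k)"
  by (simp add: dist_act_left act_mult len_def)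

lemma len_inv [simp]: "g \<in> carrier G \<Longrightarrow> len (inv g) = len g"
  using dist_act_right[of "inv g" p p] by (simp add: len_def dist_commute)

lemma len_mult: "\<lbrakk>g \<in> carrier G; k \<in> carrier G\<rbrakk> \<Longrightarrow> len (g \<otimes> k) \<le> len g + len k"
  using dist_triangle[of p "\<phi> g (\<phi> k p)" "\<phi> g p"] by (simp add: len_def act_mult)

end

section \<open>The axis of a contracting element\<close>

locale powers_axis = isometry_group +
  fixes h
  assumes h_closed [simp]: "h \<in> carrier G"
    and finite_pow: "finite {i::int. len (h [^] i) \<le> r}"
begin

definition axis_pt :: "int \<Rightarrow> 'c" where
  "axis_pt i = \<phi> (h [^] i) p"

text \<open>A relation, since ties may occur. In the main argument it replaces the coarse map
  \<open>\<pi>\<close>, as the points \<open>axis_pt i\<close> replace \<open>A\<close>.\<close>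

definition nearest :: "'c \<Rightarrow> int \<Rightarrow> bool" where
  "nearest x i \<longleftrightarrow> (\<forall>j. dist x (axis_pt i) \<le> dist x (axis_pt j))"

lemma axis_pt_0 [simp]: "axis_pt 0 = p"
  by (simp add: axis_pt_def)

lemma dist_axis_pt: "dist (axis_pt i) (axis_pt j) = len (h [^] (j - i))"
  using dist_orbit[of "h [^] i" "h [^] j"] int_pow_mult[of h "-i" j]
  by (simp add: axis_pt_def int_pow_neg)

lemma dist_p_axis_pt: "dist p (axis_pt j) = len (h [^] j)"
  using dist_axis_pt[of 0 j] by simp

lemma len_pow_minus [simp]: "len (h [^] (- i :: int)) = len (h [^] i)"
  by (simp add: int_pow_neg)

lemma act_pow_axis_pt: "\<phi> (h [^] i) (axis_pt j) = axis_pt (i + j)"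
  by (simp add: axis_pt_def act_mult int_pow_mult)

text \<open>\<open>finite_pow\<close> counts exponents, not group elements, so a trivial power would
  give infinitely many exponents of length 0.\<close>

lemma pow_eq_one_iff: "h [^] (i::int) = \<one> \<longleftrightarrow> i = 0"
proof
  assume one: "h [^] i = \<one>"
  have "h [^] (i * j) = \<one>" for j
    using int_pow_pow[of h i j] one by simp
  then have "range (\<lambda>n. i * int n) \<subseteq> {k. len (h [^] k) \<le> 0}"
    by auto
  then have "finite (range (\<lambda>n. i * int n))"
    using finite_pow finite_subset by blast
  then show "i = 0"
    using range_inj_infinite[of "\<lambda>n. i * int n"] by (auto simp: inj_on_def)
qed simp

lemma pow_eq_iff: "h [^] (i::int) = h [^] j \<longleftrightarrow> i = j"
proof
  assume "h [^] i = h [^] j"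
  then have "h [^] (i - j) = \<one>"
    by (simp add: int_pow_diff)
  then show "i = j"
    by (simp add: pow_eq_one_iff)
qed simp

lemma ex_large_pow: "\<exists>n::nat. 0 < n \<and> r < len (h [^] int n)"
proof (rule ccontr)
  assume "\<not> ?thesis"
  then have "len (h [^] int n) \<le> r" if "0 < n" for n
    using that not_less by blast
  then have "int ` {0<..} \<subseteq> {i. len (h [^] i) \<le> r}"
    by blast
  then have "finite (int ` {0::nat<..})"
    using finite_pow finite_subset by blast
  then show False
    using finite_imageD[of int "{0::nat<..}"] infinite_Ioi[of "0::nat"] by auto
qed

lemma ex_large_pow_mult:
  assumes "m \<noteq> 0"
  shows "\<exists>n::nat. r < len (h [^] (m * int n))"
proof (rule ccontr)
  assume "\<not> ?thesis"
  then have "len (h [^] (m * int n)) \<le> r" for n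
    using not_less by blast
  then have "range (\<lambda>n. m * int n) \<subseteq> {i. len (h [^] i) \<le> r}"
    by blast
  then have "finite (range (\<lambda>n. m * int n))"
    using finite_pow finite_subset by blast
  then show False
    using range_inj_infinite[of "\<lambda>n. m * int n"] assms by (auto simp: inj_on_def)
qed

lemma ex_nr: "\<exists>i. nearest x i"
proof -
  define S where "S = {i. dist x (axis_pt i) \<le> dist x p}"
  have "S \<subseteq> {i. len (h [^] i) \<le> 2 * dist x p}"
  proof
    fix i assume "i \<in> S"
    then show "i \<in> {i. len (h [^] i) \<le> 2 * dist x p}"
      using dist_triangle3[of p "axis_pt i" x] by (simp add: S_def dist_p_axis_pt)
  qed
  then have "finite S"
    using finite_pow finite_subset by blast
  moreover have "0 \<in> S"
    by (simp add: S_def)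
  ultimately obtain i where i: "i \<in> S" "\<And>j. j \<in> S \<Longrightarrow> dist x (axis_pt i) \<le> dist x (axis_pt j)"
    using arg_min_if_finite[of S "\<lambda>i. dist x (axis_pt i)"] by (metis empty_iff not_less)
  then have "nearest x i"
    unfolding nearest_def S_def by (smt (verit) mem_Collect_eq)
  then show ?thesis ..
qed

lemma nearest_act_pow: "nearest (\<phi> (h [^] m) x) k \<longleftrightarrow> nearest x (k - m)"
proof -
  have *: "dist (\<phi> (h [^] m) x) (axis_pt j) = dist x (axis_pt (j - m))" for j
    using act_isometry[of "h [^] m" x "axis_pt (j - m)"] by (simp add: act_pow_axis_pt)
  show ?thesis
    unfolding nearest_def * by (metis add_diff_cancel_right')
qed

lemma nearest_axis_pt: "nearest (axis_pt i) i"
  by (simp add: nearest_def)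

definition proj_within :: "real \<Rightarrow> 'c \<Rightarrow> bool" where
  "proj_within \<tau> x \<longleftrightarrow> (\<forall>k. nearest x k \<longrightarrow> len (h [^] k) \<le> \<tau>)"

lemma proj_withinD: "\<lbrakk>proj_within \<tau> x; nearest x k\<rbrakk> \<Longrightarrow> len (h [^] k) \<le> \<tau>"
  by (simp add: proj_within_def)

lemma proj_within_mono: "\<lbrakk>proj_within \<tau> x; \<tau> \<le> \<tau>'\<rbrakk> \<Longrightarrow> proj_within \<tau>' x"
  unfolding proj_within_def by force

lemma proj_within_base: "0 \<le> \<tau> \<Longrightarrow> proj_within \<tau> p"
  unfolding proj_within_def nearest_def by (metis dist_p_axis_pt dist_self axis_pt_0 order_trans)

end

locale contracting_axis = powers_axis +
  fixes D
  assumes D_nonneg: "0 \<le> D"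
    and reverse_triangle:
      "\<lbrakk>nearest x i; nearest y j; D \<le> dist (axis_pt i) (axis_pt j)\<rbrakk>
        \<Longrightarrow> dist x (axis_pt i) + dist (axis_pt i) (axis_pt j) + dist (axis_pt j) y - D \<le> dist x y"
begin

lemma nearest_coarsely_lipschitz:
  assumes "nearest x i" "nearest y j"
  shows "dist (axis_pt i) (axis_pt j) \<le> D + dist x y"
proof (cases "D \<le> dist (axis_pt i) (axis_pt j)")
  case True
  then show ?thesis
    using reverse_triangle[OF assms True] by (smt (verit) zero_le_dist)
next
  case False
  then show ?thesis
    by (smt (verit) zero_le_dist)
qed

lemma proj_within_nearby:
  assumes "proj_within \<tau> x"
  shows "proj_within (\<tau> + D + dist x y) y"
  unfolding proj_within_def
proof (intro allI impI)
  fix k assume k: "nearest y k"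
  obtain i where i: "nearest x i"
    using ex_nr by blast
  show "len (h [^] k) \<le> \<tau> + D + dist x y"
    using nearest_coarsely_lipschitz[OF i k] proj_withinD[OF assms i] dist_triangle[of p "axis_pt k" "axis_pt i"]
    by (simp add: dist_p_axis_pt)
qed

text \<open>The reverse triangle inequalities on both sides of \<open>w\<close> count
  \<open>dist w (axis_pt c)\<close> twice, while the detour through \<open>w\<close> costs at most
  \<open>\<kappa>\<close>.\<close>

lemma near_axis_of_aligned:
  assumes "nearest x i" "nearest w c" "nearest y j" "D \<le> dist (axis_pt i) (axis_pt c)" "D \<le> dist (axis_pt c) (axis_pt j)"
    and "dist x w + dist w y \<le> dist x y + \<kappa>"
  shows "dist w (axis_pt c) \<le> D + \<kappa> / 2"
  using reverse_triangle[OF assms(1,2,4)] reverse_triangle[OF assms(2,3,5)] assms(6)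
    dist_triangle[of x y "axis_pt i"] dist_triangle[of "axis_pt i" y "axis_pt c"] dist_triangle[of "axis_pt c" y "axis_pt j"]
  by (simp add: dist_commute)

lemma near_axis_of_between_axis_pt:
  assumes "dist (axis_pt i) z + dist z (axis_pt k) = dist (axis_pt i) (axis_pt k)" "nearest z l"
  shows "dist z (axis_pt l) \<le> 2 * D"
proof -
  have near: "dist z (axis_pt l) \<le> dist (axis_pt i) z" "dist z (axis_pt l) \<le> dist z (axis_pt k)"
    using assms(2) by (simp_all add: nearest_def dist_commute)
  have tri: "dist (axis_pt i) (axis_pt k) \<le> dist (axis_pt i) (axis_pt l) + dist (axis_pt l) (axis_pt k)"
    by (rule dist_triangle)
  have left: "dist (axis_pt i) (axis_pt l) + dist z (axis_pt l) \<le> dist (axis_pt i) z + D" if "D \<le> dist (axis_pt i) (axis_pt l)"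
    using reverse_triangle[OF nearest_axis_pt assms(2) that] by (simp add: dist_commute)
  have right: "dist z (axis_pt l) + dist (axis_pt l) (axis_pt k) \<le> dist z (axis_pt k) + D" if "D \<le> dist (axis_pt l) (axis_pt k)"
    using reverse_triangle[OF assms(2) nearest_axis_pt that] by simp
  show ?thesis
    using near tri left right assms(1) D_nonneg by linarith
qed

text \<open>A geodesic between two orbit points stays near the axis, hence somewhere switches from
  being close to earlier points to being close to later points than \<^term>\<open>axis_pt j\<close>.\<close>

lemma axis_pt_aligned:
  assumes geod: "geodesic_space TYPE('c)"
  shows "\<exists>\<kappa>\<ge>0. \<forall>i j k. i \<le> j \<and> j \<le> k \<longrightarrow>
    dist (axis_pt i) (axis_pt j) + dist (axis_pt j) (axis_pt k) \<le> dist (axis_pt i) (axis_pt k) + \<kappa>"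
proof -
  \<comment> \<open>\<open>4 * D + 1\<close> bounds the distance between two axis points that are
    \<open>2 * D\<close>-close to points of the geodesic at most 1 apart. So \<open>m\<close> bounds
    the jump in exponent across \<open>j\<close>, and \<open>\<mu>\<close> the resulting
    error.\<close>
  define S where "S = {n::int. len (h [^] n) \<le> 4 * D + 1}"
  have "finite S"
    unfolding S_def by (rule finite_pow)
  then obtain m where m: "\<And>n. n \<in> S \<Longrightarrow> n \<le> m"
    using bdd_above_finite[of S] by (auto simp: bdd_above_def)
  define \<mu> where "\<mu> = Max ((\<lambda>n. len (h [^] n)) ` {0..max 0 m})"
  have \<mu>: "len (h [^] n) \<le> \<mu>" if "0 \<le> n" "n \<le> m" for n
    unfolding \<mu>_def using that by (intro Max_ge) auto
  have "0 \<le> \<mu>"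
    unfolding \<mu>_def
    by (rule order_trans[OF len_nonneg[of "h [^] (0::int)"]], rule Max_ge, simp, rule imageI) simp
  have "dist (axis_pt i) (axis_pt j) + dist (axis_pt j) (axis_pt k) \<le> dist (axis_pt i) (axis_pt k) + 2 * (2 * D + \<mu>)"
    if ijk: "i \<le> j" "j \<le> k" for i j k
  proof -
    define L where "L = dist (axis_pt i) (axis_pt k)"
    obtain \<alpha> where "is_geodesic \<alpha> (axis_pt i) (axis_pt k)"
      using geod by (auto simp: geodesic_space_def)
    then have \<alpha>: "\<alpha> 0 = axis_pt i" "\<alpha> L = axis_pt k"
      and iso: "\<And>s t. \<lbrakk>s \<in> {0..L}; t \<in> {0..L}\<rbrakk> \<Longrightarrow> dist (\<alpha> s) (\<alpha> t) = \<bar>s - t\<bar>"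
      by (auto simp: is_geodesic_def L_def)
    have L: "0 \<le> L"
      by (simp add: L_def)
    define P where "P = {t \<in> {0..L}. \<exists>l\<le>j. dist (\<alpha> t) (axis_pt l) \<le> 2 * D}"
    have "0 \<in> P"
      using \<alpha> ijk L D_nonneg by (auto simp: P_def intro!: exI[of _ i])
    have bdd: "bdd_above P"
      by (rule bdd_aboveI[of _ L]) (simp add: P_def)
    have "Sup P \<le> L"
      using \<open>0 \<in> P\<close> by (intro cSup_least) (auto simp: P_def)
    obtain t where t: "t \<in> P" "Sup P - 1/2 < t"
      using less_cSupD[of P "Sup P - 1/2"] \<open>0 \<in> P\<close> by auto
    then obtain l where l: "l \<le> j" "dist (\<alpha> t) (axis_pt l) \<le> 2 * D"
      by (auto simp: P_def)
    \<comment> \<open>Unless it is the end of the geodesic, this lies past \<open>Sup P\<close>, so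
      an axis point \<open>2 * D\<close>-close to \<open>\<alpha> t'\<close> has exponent above
      \<open>j\<close>.\<close>
    define t' where "t' = min L (Sup P + 1/2)"
    have "t \<le> Sup P"
      using t bdd by (intro cSup_upper)
    then have t': "t' \<in> {0..L}" "t \<le> t'" "t' \<le> t + 1"
      using t \<open>Sup P \<le> L\<close> L by (auto simp: t'_def P_def)
    have "\<exists>l'\<ge>j. dist (\<alpha> t') (axis_pt l') \<le> 2 * D"
    proof (cases "t' = L")
      case True
      then show ?thesis
        using \<alpha> ijk D_nonneg by (auto intro!: exI[of _ k])
    next
      case False
      then have "Sup P < t'"
        by (auto simp: t'_def min_def split: if_splits)
      then have "t' \<notin> P"
        using cSup_upper[OF _ bdd, of t'] by auto
      obtain l' where l': "nearest (\<alpha> t') l'"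
        using ex_nr by blast
      have "dist (\<alpha> t') (axis_pt l') \<le> 2 * D"
        using near_axis_of_between_axis_pt[of i "\<alpha> t'" k l'] l' iso[of 0 t'] iso[of t' L] t' L \<alpha>
        by (simp add: L_def)
      then show ?thesis
        using \<open>t' \<notin> P\<close> t' by (auto simp: P_def intro!: exI[of _ l']) (meson linear)
    qed
    then obtain l' where l': "j \<le> l'" "dist (\<alpha> t') (axis_pt l') \<le> 2 * D"
      by blast
    have tP: "t \<in> {0..L}"
      using t by (simp add: P_def)
    have "dist (axis_pt l) (axis_pt l') \<le> 4 * D + 1"
      using l l' iso[of t t'] tP t' dist_triangle[of "axis_pt l" "axis_pt l'" "\<alpha> t"]
        dist_triangle[of "\<alpha> t" "axis_pt l'" "\<alpha> t'"] by (simp add: dist_commute)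
    then have "l' - l \<le> m"
      by (intro m) (simp add: S_def dist_axis_pt)
    then have "dist (axis_pt l) (axis_pt j) \<le> \<mu>"
      using l l' by (simp add: dist_axis_pt \<mu>)
    then have "dist (\<alpha> t) (axis_pt j) \<le> 2 * D + \<mu>"
      using l dist_triangle[of "\<alpha> t" "axis_pt j" "axis_pt l"] by simp
    moreover have "dist (axis_pt i) (\<alpha> t) = t" "dist (\<alpha> t) (axis_pt k) = L - t"
      using iso[of 0 t] iso[of t L] tP L \<alpha> by auto
    ultimately show ?thesis
      using dist_triangle[of "axis_pt i" "axis_pt j" "\<alpha> t"] dist_triangle3[of "axis_pt j" "axis_pt k" "\<alpha> t"]
      by (simp add: L_def)
  qed
  then show ?thesis
    using D_nonneg \<open>0 \<le> \<mu>\<close> by (intro exI[of _ "2 * (2 * D + \<mu>)"]) auto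
qed

end

text \<open>Transfers contraction from \<open>A\<close> to the orbit of \<open>p\<close> under the
  powers of \<open>h\<close>. Were \<open>axis_pt i\<close> far from \<open>c\<close>, the reverse
  triangle inequality would make it farther from \<open>x\<close> than an axis point close to
  \<open>c\<close>, so it would not be nearest.\<close>

lemma (in powers_axis) contracting_axis_of_projection:
  assumes "contracting_projection \<pi> A C"
    and A_near: "\<And>a. a \<in> A \<Longrightarrow> \<exists>j. dist a (axis_pt j) \<le> \<rho>"
    and axis_pt_near: "\<And>i. \<exists>a\<in>A. dist (axis_pt i) a \<le> \<rho>"
  obtains D where "contracting_axis G \<phi> p h D"
proof -
  interpret contracting_projection \<pi> A C
    by fact
  define C' where "C' = 77 * C + 3 * \<rho>"
  have "0 \<le> \<rho>"
    using axis_pt_near[of 0] by (meson order_trans zero_le_dist)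
  have near: "dist c (axis_pt i) \<le> C'" if "nearest x i" and c: "c \<in> \<pi> x" for x i c
  proof -
    obtain a where a: "a \<in> A" "dist (axis_pt i) a \<le> \<rho>"
      using axis_pt_near by blast
    obtain j where j: "dist c (axis_pt j) \<le> \<rho>"
      using A_near[of c] c proj_subset[of x] by blast
    obtain e where e: "e \<in> \<pi> a"
      using proj_nonempty by blast
    have ae: "dist a e \<le> C"
      using proj_of_mem a e by blast
    show ?thesis
    proof (cases "15 * C < dist c e")
      case True
      have "dist x (axis_pt i) \<le> dist x (axis_pt j)"
        using that by (simp add: nearest_def)
      then show ?thesis
        using proj_reverse_triangle[OF that(2) e True] a j ae dist_triangle[of x a "axis_pt i"]
          dist_triangle[of x "axis_pt j" c] dist_triangle[of c "axis_pt i" e] dist_triangle[of e "axis_pt i" a]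
          C_pos
        by (simp add: C'_def dist_commute)
    next
      case False
      then show ?thesis
        using a ae dist_triangle[of c "axis_pt i" e] dist_triangle[of e "axis_pt i" a] C_pos \<open>0 \<le> \<rho>\<close>
        by (simp add: C'_def dist_commute)
    qed
  qed
  \<comment> \<open>\<open>76 * C\<close> is the loss for \<open>c\<close> and \<open>e\<close>;
    replacing them by axis points changes the three distances by \<open>4 * C'\<close> in
    all.\<close>
  have "contracting_axis G \<phi> p h (76 * C + 4 * C' + 1)"
  proof unfold_locales
    show "0 \<le> 76 * C + 4 * C' + 1"
      using C_pos \<open>0 \<le> \<rho>\<close> by (simp add: C'_def)
    show "dist x (axis_pt i) + dist (axis_pt i) (axis_pt j) + dist (axis_pt j) y - (76 * C + 4 * C' + 1) \<le> dist x y"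
      if "nearest x i" "nearest y j" and far: "76 * C + 4 * C' + 1 \<le> dist (axis_pt i) (axis_pt j)" for x y i j
    proof -
      obtain c e where ce: "c \<in> \<pi> x" "e \<in> \<pi> y"
        using proj_nonempty by blast
      have ci: "dist c (axis_pt i) \<le> C'" and ej: "dist e (axis_pt j) \<le> C'"
        using near that ce by blast+
      have ij: "dist (axis_pt i) (axis_pt j) \<le> dist c e + 2 * C'"
        using ci ej dist_triangle[of "axis_pt i" "axis_pt j" c] dist_triangle[of c "axis_pt j" e]
        by (simp add: dist_commute)
      then have "15 * C < dist c e"
        using far C_pos \<open>0 \<le> \<rho>\<close> by (simp add: C'_def)
      from proj_reverse_triangle[OF ce this] show ?thesis
        using ij ci ej dist_triangle[of x "axis_pt i" c] dist_triangle[of "axis_pt j" y e]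
        by (simp add: dist_commute)
    qed
  qed
  then show thesis
    by (rule that)
qed

section \<open>The commensurator of the axis\<close>

context contracting_axis
begin

text \<open>Membership in the commensurator of the infinite cyclic group of \<open>h\<close>,
  written without inverses.\<close>

definition commensurating :: "'a \<Rightarrow> bool" where
  "commensurating g \<longleftrightarrow> g \<in> carrier G \<and>
     (\<exists>(m::int) (n::int). m \<noteq> 0 \<and> n \<noteq> 0 \<and> g \<otimes> h [^] m = h [^] n \<otimes> g)"

text \<open>By equivariance the points \<open>\<phi> g (axis_pt (m * i))\<close>, with
  \<open>i\<close> large of either sign, project to \<open>c + n * i\<close>, far from the
  projection \<open>c\<close> of \<open>\<phi> g p\<close>. As \<open>\<phi> g p\<close> lies almost
  between them, \<open>near_axis_of_aligned\<close> applies.\<close>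

lemma commensurating_near_axis:
  assumes al: "\<And>i j k. \<lbrakk>i \<le> j; j \<le> k\<rbrakk> \<Longrightarrow>
      dist (axis_pt i) (axis_pt j) + dist (axis_pt j) (axis_pt k) \<le> dist (axis_pt i) (axis_pt k) + \<kappa>"
    and "commensurating g"
  shows "\<exists>c. dist (\<phi> g p) (axis_pt c) \<le> D + \<kappa> / 2"
proof -
  obtain m n :: int where g: "g \<in> carrier G" and mn: "m \<noteq> 0" "n \<noteq> 0"
    and comm: "g \<otimes> h [^] m = h [^] n \<otimes> g"
    using assms(2) by (auto simp: commensurating_def)
  have inv_g: "h [^] m = inv g \<otimes> h [^] n \<otimes> g"
    using comm g by (simp add: m_assoc) (metis g h_closed int_pow_closed inv_solve_left m_closed)
  have "h [^] (m * i) = inv g \<otimes> h [^] (n * i) \<otimes> g" for i :: int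
  proof -
    have "(inv g \<otimes> h [^] n \<otimes> g) [^] i = inv g \<otimes> (h [^] n) [^] i \<otimes> g"
    proof -
      define \<theta> where "\<theta> = (\<lambda>x. inv g \<otimes> x \<otimes> g)"
      have "\<theta> \<in> hom G G"
        using g by (auto simp: \<theta>_def hom_def m_assoc inv_solve_left)
          (simp add: m_assoc[symmetric])
      then interpret \<theta>: group_hom G G \<theta>
        by unfold_locales
      show ?thesis
        using \<theta>.hom_int_pow[of "h [^] n" i] by (simp add: \<theta>_def)
    qed
    then show ?thesis
      by (simp add: int_pow_pow flip: inv_g)
  qed
  then have comm_i: "g \<otimes> h [^] (m * i) = h [^] (n * i) \<otimes> g" for i :: int
    using g by (simp add: m_assoc[symmetric])
  obtain c where c: "nearest (\<phi> g p) c"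
    using ex_nr by blast
  have nearest: "nearest (\<phi> g (axis_pt (m * i))) (c + n * i)" for i
  proof -
    have "\<phi> g (axis_pt (m * i)) = \<phi> (h [^] (n * i)) (\<phi> g p)"
      using comm_i[of i] g by (simp add: axis_pt_def flip: act_mult)
    then show ?thesis
      using c by (simp add: nearest_act_pow)
  qed
  obtain i :: nat where i: "D < len (h [^] (n * int i))"
    using ex_large_pow_mult mn by blast
  have far: "D \<le> dist (axis_pt (c + n * - int i)) (axis_pt c)" "D \<le> dist (axis_pt c) (axis_pt (c + n * int i))"
    using i by (simp_all add: dist_axis_pt)
  have "dist (axis_pt (m * - int i)) (axis_pt 0) + dist (axis_pt 0) (axis_pt (m * int i))
      \<le> dist (axis_pt (m * - int i)) (axis_pt (m * int i)) + \<kappa>"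
  proof (cases "0 \<le> m")
    case True
    then show ?thesis
      by (intro al) simp_all
  next
    case False
    then have "m * int i \<le> 0"
      by (simp add: mult_nonpos_nonneg)
    then show ?thesis
      using al[of "m * int i" 0 "m * - int i"] by (simp add: dist_commute)
  qed
  then have "dist (\<phi> g (axis_pt (m * - int i))) (\<phi> g p) + dist (\<phi> g p) (\<phi> g (axis_pt (m * int i)))
      \<le> dist (\<phi> g (axis_pt (m * - int i))) (\<phi> g (axis_pt (m * int i))) + \<kappa>"
    using g by simp
  then show ?thesis
    using near_axis_of_aligned[OF nearest c nearest far] by blast
qed

text \<open>If the projection is unbounded, infinitely many points of one ray of the translated axis
  lie almost between points with distant projections, hence close to the axis. The elements
  \<open>w n\<close> comparing both axes there have bounded length, so two coincide, and this makes
  \<open>g\<close> commensurating.\<close>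

lemma not_commensurating_bounded_proj:
  assumes al: "\<And>i j k. \<lbrakk>i \<le> j; j \<le> k\<rbrakk> \<Longrightarrow>
      dist (axis_pt i) (axis_pt j) + dist (axis_pt j) (axis_pt k) \<le> dist (axis_pt i) (axis_pt k) + \<kappa>"
    and g: "g \<in> carrier G" "\<not> commensurating g"
  shows "\<exists>B. \<forall>i. proj_within B (\<phi> g (axis_pt i))"
proof (rule ccontr)
  assume unbounded: "\<not> ?thesis"
  obtain c where c: "\<And>i. nearest (\<phi> g (axis_pt i)) (c i)"
    using choice[of "\<lambda>i. nearest (\<phi> g (axis_pt i))"] ex_nr by blast
  have c_unbounded: "\<exists>i. B < len (h [^] c i)" for B
  proof -
    obtain i where "\<not> proj_within (B + D) (\<phi> g (axis_pt i))"
      using unbounded by blast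
    then obtain k where k: "nearest (\<phi> g (axis_pt i)) k" "B + D < len (h [^] k)"
      by (auto simp: proj_within_def not_le)
    have "B < len (h [^] c i)"
      using nearest_coarsely_lipschitz[OF k(1) c[of i]] k(2) dist_triangle2[of p "axis_pt k" "axis_pt (c i)"]
      by (simp add: dist_p_axis_pt)
    then show ?thesis ..
  qed
  \<comment> \<open>One of the two rays already has unbounded projection; \<open>\<sigma>\<close> is
    its direction.\<close>
  have "\<exists>\<sigma>::int. (\<sigma> = 1 \<or> \<sigma> = -1) \<and> (\<forall>B. \<exists>n::nat. B < len (h [^] c (\<sigma> * int n)))"
  proof (rule ccontr)
    assume *: "\<not> ?thesis"
    then obtain B1 B2 where B: "\<And>n::nat. len (h [^] c (int n)) \<le> B1"
      "\<And>n::nat. len (h [^] c (- int n)) \<le> B2"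
      by (metis linorder_not_less mult_1 mult_minus1)
    obtain i where "max B1 B2 < len (h [^] c i)"
      using c_unbounded by blast
    then show False
      using B[of "nat \<bar>i\<bar>"] by (cases "0 \<le> i") auto
  qed
  then obtain \<sigma> :: int where \<sigma>: "\<sigma> = 1 \<or> \<sigma> = -1"
    and un: "\<And>B. \<exists>n::nat. B < len (h [^] c (\<sigma> * int n))"
    by blast
  define d where "d n = c (\<sigma> * int n)" for n :: nat
  have beyond: "\<exists>n'>n. B < len (h [^] d n')" for n :: nat and B
  proof -
    define B' where "B' = max B (Max ((\<lambda>n. len (h [^] d n)) ` {..n}))"
    have le: "len (h [^] d n') \<le> B'" if "n' \<le> n" for n'
      unfolding B'_def using that by (intro max.coboundedI2 Max_ge) auto
    obtain n' where n': "B' < len (h [^] d n')"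
      using un[of B'] by (auto simp: d_def)
    have "n < n'"
      using n' le[of n'] by (meson not_le)
    moreover have "B < len (h [^] d n')"
      using n' by (simp add: B'_def)
    ultimately show ?thesis
      by blast
  qed
  define K where "K = {n. D \<le> dist (axis_pt (d 0)) (axis_pt (d n))}"
  have far_ex: "\<exists>n'>n. D \<le> dist (axis_pt (d k)) (axis_pt (d n'))" for n k
  proof -
    obtain n' where "n' > n" "D + len (h [^] d k) < len (h [^] d n')"
      using beyond by blast
    then show ?thesis
      using dist_triangle[of p "axis_pt (d n')" "axis_pt (d k)"] by (intro exI[of _ n']) (simp add: dist_p_axis_pt)
  qed
  have "infinite K"
    unfolding infinite_nat_iff_unbounded
  proof
    fix n
    show "\<exists>m>n. m \<in> K"
      using far_ex[of n 0] by (simp add: K_def)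
  qed
  define w where "w n = h [^] (- d n) \<otimes> g \<otimes> h [^] (\<sigma> * int n)" for n
  have w_closed: "w n \<in> carrier G" for n
    using g by (simp add: w_def)
  have w_len: "len (w n) \<le> D + \<kappa> / 2" if "n \<in> K" for n
  proof -
    obtain n' where n': "n' > n" "D \<le> dist (axis_pt (d n)) (axis_pt (d n'))"
      using far_ex by blast
    have "dist (axis_pt 0) (axis_pt (\<sigma> * int n)) + dist (axis_pt (\<sigma> * int n)) (axis_pt (\<sigma> * int n'))
        \<le> dist (axis_pt 0) (axis_pt (\<sigma> * int n')) + \<kappa>"
      using \<sigma> n'(1) al[of 0 "int n" "int n'"] al[of "- int n'" "- int n" 0]
      by (auto simp: dist_commute)
    then have al_g: "dist (\<phi> g (axis_pt 0)) (\<phi> g (axis_pt (\<sigma> * int n)))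
          + dist (\<phi> g (axis_pt (\<sigma> * int n))) (\<phi> g (axis_pt (\<sigma> * int n')))
        \<le> dist (\<phi> g (axis_pt 0)) (\<phi> g (axis_pt (\<sigma> * int n'))) + \<kappa>"
      using g by (simp del: axis_pt_0)
    have nearest_d: "nearest (\<phi> g (axis_pt (\<sigma> * int n))) (d n)" for n
      using c by (simp add: d_def)
    have "dist (\<phi> g (axis_pt (\<sigma> * int n))) (axis_pt (d n)) \<le> D + \<kappa> / 2"
      using near_axis_of_aligned[OF nearest_d[of 0] nearest_d nearest_d _ n'(2)] al_g that by (simp add: K_def)
    moreover have "dist (\<phi> g (axis_pt (\<sigma> * int n))) (axis_pt (d n)) = len (w n)"
      using g dist_orbit[of "h [^] d n" "g \<otimes> h [^] (\<sigma> * int n)"]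
      by (simp add: axis_pt_def w_def act_mult int_pow_neg m_assoc dist_commute)
    ultimately show ?thesis
      by simp
  qed
  have "w ` K \<subseteq> {x \<in> carrier G. len x \<le> D + \<kappa> / 2}"
    using w_len w_closed by auto
  then have "finite (w ` K)"
    using finite_len_le finite_subset by blast
  then have "\<not> inj_on w K"
    using \<open>infinite K\<close> finite_imageD by blast
  then obtain n n' where n: "n \<noteq> n'" "w n = w n'"
    by (auto simp: inj_on_def)
  define a b where "a = \<sigma> * int n" and "b = \<sigma> * int n'"
  have ab: "a \<noteq> b"
    using n \<sigma> by (auto simp: a_def b_def)
  have "h [^] d n' \<otimes> w n \<otimes> h [^] (- b) = h [^] d n' \<otimes> w n' \<otimes> h [^] (- b)"
    using n by simp
  moreover have "h [^] d n' \<otimes> w n \<otimes> h [^] (- b)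
      = (h [^] d n' \<otimes> h [^] (- d n)) \<otimes> g \<otimes> (h [^] a \<otimes> h [^] (- b))"
    using g by (simp add: w_def a_def m_assoc)
  moreover have "h [^] d n' \<otimes> w n' \<otimes> h [^] (- b)
      = (h [^] d n' \<otimes> h [^] (- d n')) \<otimes> g \<otimes> (h [^] b \<otimes> h [^] (- b))"
    using g by (simp add: w_def b_def m_assoc)
  ultimately have eq: "h [^] (d n' - d n) \<otimes> g \<otimes> h [^] (a - b) = g"
    using g by (simp flip: int_pow_mult)
  then have comm: "g \<otimes> h [^] (b - a) = h [^] (d n' - d n) \<otimes> g"
  proof -
    have "h [^] (d n' - d n) \<otimes> g \<otimes> h [^] (a - b) \<otimes> h [^] (b - a) = h [^] (d n' - d n) \<otimes> g"
      using g by (simp add: m_assoc flip: int_pow_mult)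
    then show ?thesis
      by (simp add: eq)
  qed
  have "d n' - d n \<noteq> 0"
  proof
    assume "d n' - d n = 0"
    then have "g \<otimes> h [^] (b - a) = g"
      using comm g by simp
    then have "h [^] (b - a) = \<one>"
      using g by simp
    then show False
      using ab by (simp add: pow_eq_one_iff)
  qed
  then show False
    using g comm ab unfolding commensurating_def by (metis diff_eq_diff_eq diff_self)
qed

text \<open>Commensurating elements move \<open>p\<close> close to the axis, so suitable powers of
  \<open>h\<close> bring them all into one finite set, where two elements of \<open>S\<close>
  meet.\<close>

lemma commensurating_pigeonhole:
  assumes geod: "geodesic_space TYPE('c)"
    and S: "\<And>g. g \<in> S \<Longrightarrow> commensurating g" "infinite S"
  shows "\<exists>a\<in>S. \<exists>b\<in>S. \<exists>k::int. k \<noteq> 0 \<and> a = h [^] k \<otimes> b"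
proof -
  obtain \<kappa> where al: "\<And>i j k. \<lbrakk>i \<le> j; j \<le> k\<rbrakk> \<Longrightarrow>
      dist (axis_pt i) (axis_pt j) + dist (axis_pt j) (axis_pt k) \<le> dist (axis_pt i) (axis_pt k) + \<kappa>"
    using axis_pt_aligned[OF geod] by blast
  have S_closed: "g \<in> carrier G" if "g \<in> S" for g
    using S(1)[OF that] by (simp add: commensurating_def)
  obtain c where c: "\<And>g. g \<in> S \<Longrightarrow> dist (\<phi> g p) (axis_pt (c g)) \<le> D + \<kappa> / 2"
    using commensurating_near_axis[OF al S(1)] by metis
  define w where "w g = h [^] (- c g) \<otimes> g" for g
  have "w ` S \<subseteq> {x \<in> carrier G. len x \<le> D + \<kappa> / 2}"
  proof clarify
    fix g assume "g \<in> S"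
    moreover from this have "dist (\<phi> g p) (axis_pt (c g)) = len (w g)"
      using dist_orbit[of "h [^] c g" g] S_closed by (simp add: axis_pt_def w_def int_pow_neg dist_commute)
    ultimately show "w g \<in> carrier G \<and> len (w g) \<le> D + \<kappa> / 2"
      using c[of g] S_closed by (simp add: w_def)
  qed
  then have "finite (w ` S)"
    using finite_len_le finite_subset by blast
  then have "\<not> inj_on w S"
    using S(2) finite_imageD by blast
  then obtain a b where ab: "a \<in> S" "b \<in> S" "a \<noteq> b" "w a = w b"
    by (auto simp: inj_on_def)
  have "h [^] c a \<otimes> w a = a"
    using S_closed[OF ab(1)] by (simp add: w_def m_assoc[symmetric] flip: int_pow_mult)
  moreover have "h [^] c a \<otimes> w b = h [^] (c a - c b) \<otimes> b"
    using S_closed[OF ab(2)] by (simp add: w_def m_assoc[symmetric] flip: int_pow_mult)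
  ultimately have "a = h [^] (c a - c b) \<otimes> b"
    using ab by simp
  moreover from this have "c a - c b \<noteq> 0"
    using ab S_closed by auto
  ultimately show ?thesis
    using ab by blast
qed

lemma elementary_of_commensurating:
  assumes geod: "geodesic_space TYPE('c)"
    and all: "\<And>g. g \<in> carrier G \<Longrightarrow> commensurating g"
  shows "elementary_group G"
proof -
  obtain \<kappa> where al: "\<And>i j k. \<lbrakk>i \<le> j; j \<le> k\<rbrakk> \<Longrightarrow>
      dist (axis_pt i) (axis_pt j) + dist (axis_pt j) (axis_pt k) \<le> dist (axis_pt i) (axis_pt k) + \<kappa>"
    using axis_pt_aligned[OF geod] by blast
  define H where "H = generate G {h}"
  have H: "subgroup H G"
    unfolding H_def by (rule generate_is_subgroup) simp
  have H_eq: "H = range (\<lambda>k::int. h [^] k)"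
    unfolding H_def using generate_pow[of h] by auto
  have "rcosets\<^bsub>G\<^esub> H \<subseteq> (\<lambda>x. H #> x) ` {x \<in> carrier G. len x \<le> D + \<kappa> / 2}"
  proof
    fix U assume "U \<in> rcosets\<^bsub>G\<^esub> H"
    then obtain g where g: "g \<in> carrier G" "U = H #> g"
      by (auto simp: RCOSETS_def)
    obtain c where c: "dist (\<phi> g p) (axis_pt c) \<le> D + \<kappa> / 2"
      using commensurating_near_axis[OF al all] g by blast
    define x where "x = h [^] (- c) \<otimes> g"
    have "dist (\<phi> g p) (axis_pt c) = len x"
      using dist_orbit[of "h [^] c" g] g by (simp add: axis_pt_def x_def int_pow_neg dist_commute)
    moreover have "x \<in> U"
      using g by (auto simp: x_def r_coset_def H_eq)
    then have "U = H #> x"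
      using repr_independence[of x H g] g H by simp
    ultimately show "U \<in> (\<lambda>x. H #> x) ` {x \<in> carrier G. len x \<le> D + \<kappa> / 2}"
      using c g by (auto simp: x_def)
  qed
  then have "finite (rcosets\<^bsub>G\<^esub> H)"
    using finite_len_le finite_surj by blast
  moreover have "cyclic_group (G\<lparr>carrier := H\<rparr>)"
    using cyclic_group_generated[of h] by (simp add: subgroup_generated_def H_def)
  ultimately show ?thesis
    unfolding elementary_group_def using H by blast
qed

text \<open>Otherwise the pigeonhole applied to \<open>\<Gamma>\<close> puts some
  \<open>h [^] k\<close> into \<open>\<Gamma>\<close>; applied to the conjugates of its powers by
  any \<open>t\<close>, it shows that \<open>t\<close> is commensurating, and \<open>G\<close> would
  be elementary.\<close>

lemma ex_not_commensurating_in_normal: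
  assumes geod: "geodesic_space TYPE('c)" and "\<not> elementary_group G"
    and "\<Gamma> \<lhd> G" "infinite \<Gamma>"
  shows "\<exists>g\<in>\<Gamma>. \<not> commensurating g"
proof (rule ccontr)
  assume "\<not> ?thesis"
  then have all: "\<And>g. g \<in> \<Gamma> \<Longrightarrow> commensurating g"
    by blast
  interpret normal \<Gamma> G
    by fact
  obtain a b and k :: int where ab: "a \<in> \<Gamma>" "b \<in> \<Gamma>" and k: "k \<noteq> 0" "a = h [^] k \<otimes> b"
    using commensurating_pigeonhole[OF geod all assms(4)] by blast
  have "h [^] k = a \<otimes> inv b"
    using ab k(2) by (simp add: m_assoc)
  then have hk: "h [^] k \<in> \<Gamma>"
    using ab by simp
  have "commensurating t" if t: "t \<in> carrier G" for t
  proof -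
    define \<gamma> where "\<gamma> n = t \<otimes> h [^] (k * int n) \<otimes> inv t" for n :: nat
    have "h [^] (k * int n) \<in> \<Gamma>" for n
      using subgroup_int_pow_closed[OF subgroup_axioms hk, of "int n"]
      by (simp add: int_pow_pow)
    then have \<gamma>_mem: "\<gamma> n \<in> \<Gamma>" for n
      unfolding \<gamma>_def using t by (rule inv_op_closed2[rotated])
    have "inj \<gamma>"
    proof (rule injI)
      fix n n' assume "\<gamma> n = \<gamma> n'"
      then have "h [^] (k * int n) = h [^] (k * int n')"
        using t by (simp add: \<gamma>_def)
      then show "n = n'"
        using k by (simp add: pow_eq_iff)
    qed
    then have inf: "infinite (range \<gamma>)"
      by (rule range_inj_infinite)
    have mem: "commensurating y" if "y \<in> range \<gamma>" for y
      using that
    proof (rule imageE)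
      fix n assume "y = \<gamma> n"
      then show ?thesis
        using all[OF \<gamma>_mem[of n]] by simp
    qed
    have "\<exists>a\<in>range \<gamma>. \<exists>b\<in>range \<gamma>. \<exists>k::int. k \<noteq> 0 \<and> a = h [^] k \<otimes> b"
      by (rule commensurating_pigeonhole[OF geod mem inf])
    then obtain n n' and l :: int where l: "l \<noteq> 0" "\<gamma> n = h [^] l \<otimes> \<gamma> n'"
      by (elim bexE exE conjE imageE) simp
    define x where "x = k * (int n - int n')"
    have "\<gamma> n \<otimes> (t \<otimes> h [^] (- (k * int n'))) = t \<otimes> h [^] x"
      using t by (simp add: \<gamma>_def m_assoc inv_solve_left' x_def right_diff_distrib int_pow_diff int_pow_neg)
    moreover have "h [^] l \<otimes> \<gamma> n' \<otimes> (t \<otimes> h [^] (- (k * int n'))) = h [^] l \<otimes> t"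
    proof -
      have "\<gamma> n' \<otimes> (t \<otimes> h [^] (- (k * int n'))) = t \<otimes> (h [^] (k * int n') \<otimes> (inv t \<otimes> t) \<otimes> h [^] (- (k * int n')))"
        using t by (simp add: \<gamma>_def m_assoc del: l_inv Units_l_inv)
      also have "\<dots> = t"
        using t by (simp flip: int_pow_mult)
      finally show ?thesis
        using t by (simp add: m_assoc \<gamma>_def)
    qed
    ultimately have comm: "t \<otimes> h [^] x = h [^] l \<otimes> t"
      using l by simp
    have "x \<noteq> 0"
    proof
      assume "x = 0"
      then have "h [^] l \<otimes> t = t"
        using comm t by simp
      then have "h [^] l = \<one>"
        using t by simp
      then show False
        using l by (simp add: pow_eq_one_iff)
    qed
    then show ?thesis
      unfolding commensurating_def using t comm l(1) by blast
  qed
  then show False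
    using elementary_of_commensurating[OF geod] assms(2) by blast
qed

lemma commensurating_inv:
  assumes "commensurating g"
  shows "commensurating (inv g)"
proof -
  obtain m n :: int where g: "g \<in> carrier G" and mn: "m \<noteq> 0" "n \<noteq> 0"
    and comm: "g \<otimes> h [^] m = h [^] n \<otimes> g"
    using assms by (auto simp: commensurating_def)
  have "h [^] n = g \<otimes> (h [^] m \<otimes> inv g)"
    using g comm by (simp add: inv_solve_right flip: m_assoc)
  then have "inv g \<otimes> h [^] n = h [^] m \<otimes> inv g"
    using g inv_solve_left[of "h [^] m \<otimes> inv g" g "h [^] n"] by simp
  then show ?thesis
    unfolding commensurating_def using g mn by blast
qed

lemma ex_transverse_in_normal:
  assumes geod: "geodesic_space TYPE('c)" and "\<not> elementary_group G"
    and "\<Gamma> \<lhd> G" "infinite \<Gamma>"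
  obtains g B where "g \<in> \<Gamma>" "\<And>i. proj_within B (\<phi> g (axis_pt i))" "\<And>i. proj_within B (\<phi> (inv g) (axis_pt i))"
proof -
  obtain \<kappa> where al: "\<And>i j k. \<lbrakk>i \<le> j; j \<le> k\<rbrakk> \<Longrightarrow>
      dist (axis_pt i) (axis_pt j) + dist (axis_pt j) (axis_pt k) \<le> dist (axis_pt i) (axis_pt k) + \<kappa>"
    using axis_pt_aligned[OF geod] by blast
  obtain g where g: "g \<in> \<Gamma>" "\<not> commensurating g"
    using ex_not_commensurating_in_normal[OF assms] by blast
  then have gc: "g \<in> carrier G"
    using subgroup.mem_carrier[OF normal_imp_subgroup[OF assms(3)]] by simp
  have "\<not> commensurating (inv g)"
    using commensurating_inv[of "inv g"] g gc by auto
  then obtain B1 B2 where "\<And>i. proj_within B1 (\<phi> g (axis_pt i))" "\<And>i. proj_within B2 (\<phi> (inv g) (axis_pt i))"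
    using not_commensurating_bounded_proj[OF al gc g(2)] not_commensurating_bounded_proj[OF al, of "inv g"] gc
    by auto
  then show thesis
    using that[of g "max B1 B2"] g(1) proj_within_mono by (meson max.cobounded1 max.cobounded2)
qed

end

section \<open>Words in transverse elements\<close>

text \<open>Group elements rather than formal words: different spellings are merged, so counting
  needs the multiplicity bound in \<open>words_weight\<close>.\<close>

primrec (in monoid) words :: "'a set \<Rightarrow> nat \<Rightarrow> 'a set" where
  "words E 0 = {\<one>}"
| "words E (Suc n) = (\<lambda>(e, V). e \<otimes> V) ` (E \<times> words E n)"

lemma (in monoid) words_closed: "\<lbrakk>E \<subseteq> carrier G; V \<in> words E n\<rbrakk> \<Longrightarrow> V \<in> carrier G"
  by (induction n arbitrary: V) auto

lemma (in monoid) finite_words: "finite E \<Longrightarrow> finite (words E n)"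
  by (induction n) auto

locale transverse_axis = contracting_axis +
  fixes g B
  assumes g_closed [simp]: "g \<in> carrier G"
    and proj_g: "proj_within B (\<phi> g (axis_pt i))"
    and proj_inv_g: "proj_within B (\<phi> (inv g) (axis_pt i))"
begin

text \<open>\<open>\<tau>\<^sub>0\<close> is for letters: \<open>B + D + 1\<close> from
  \<open>proj_within_or_translate\<close>, plus \<open>D + len g\<close> for the multiplication on
  the other side. \<open>\<tau>\<^sub>1\<close> is the output of
  \<open>proj_within_transverse\<close>. \<open>\<tau>\<^sub>2\<close> is for words; its extra
  \<open>D\<close> makes \<open>reverse_triangle\<close> applicable when the bound is
  violated.\<close>

definition \<tau>\<^sub>0 :: real where "\<tau>\<^sub>0 = B + 2 * D + 1 + len g"
definition \<tau>\<^sub>1 :: real where "\<tau>\<^sub>1 = 2 * len g + 2 * B + D"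
definition \<tau>\<^sub>2 :: real where "\<tau>\<^sub>2 = \<tau>\<^sub>0 + D"

lemma B_nonneg: "0 \<le> B"
  using ex_nr proj_withinD[OF proj_g] len_nonneg order_trans by metis

lemma \<tau>_nonneg: "0 \<le> \<tau>\<^sub>0" "0 \<le> \<tau>\<^sub>1" "0 \<le> \<tau>\<^sub>2"
  using B_nonneg D_nonneg by (simp_all add: \<tau>\<^sub>0_def \<tau>\<^sub>1_def \<tau>\<^sub>2_def)

lemma transverse_inv: "transverse_axis G \<phi> p h D (inv g) B"
  by unfold_locales (simp_all add: proj_g proj_inv_g)

text \<open>The bound \<^term>\<open>\<tau>\<^sub>1\<close> does not depend on \<^term>\<open>\<tau>\<close>; this keeps the constants under
  control when the lemma is iterated along a word.\<close>

lemma proj_within_transverse: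
  assumes x: "proj_within \<tau> x" and m: "D + \<tau> + B \<le> len (h [^] (m::int))"
  shows "proj_within \<tau>\<^sub>1 (\<phi> g (\<phi> (h [^] m) x))"
  unfolding proj_within_def
proof (intro allI impI)
  fix c
  define y where "y = \<phi> (h [^] m) x"
  \<comment> \<open>\<open>a\<close> projects near \<open>p\<close> and \<open>y\<close> near
    \<open>axis_pt m\<close>, so the way from \<open>a\<close> to \<open>y\<close> passes near
    \<open>p\<close>. As \<open>axis_pt c\<close> is no farther from \<open>\<phi> g y\<close> than
    \<open>p\<close> is, \<open>a\<close> must be close to \<open>p\<close>.\<close>
  define a where "a = \<phi> (inv g) (axis_pt c)"
  assume c: "nearest (\<phi> g (\<phi> (h [^] m) x)) c"
  obtain l where l: "nearest a l"
    using ex_nr by blast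
  have l_len: "dist p (axis_pt l) \<le> B"
    using proj_withinD[OF proj_inv_g l[unfolded a_def]] by (simp add: dist_p_axis_pt)
  obtain k where k: "nearest y k"
    using ex_nr by blast
  then have k_len: "dist (axis_pt m) (axis_pt k) \<le> \<tau>"
    using proj_withinD[OF x, of "k - m"] by (simp add: y_def nearest_act_pow dist_axis_pt)
  have "len (h [^] m) \<le> dist p (axis_pt l) + dist (axis_pt l) (axis_pt k) + dist (axis_pt m) (axis_pt k)"
    using dist_triangle[of p "axis_pt m" "axis_pt l"] dist_triangle2[of "axis_pt l" "axis_pt m" "axis_pt k"]
    by (simp add: dist_p_axis_pt)
  then have far: "D \<le> dist (axis_pt l) (axis_pt k)"
    using m l_len k_len by simp
  have "dist a p + dist p y - 2 * B - D \<le> dist a y"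
    using reverse_triangle[OF l k far] dist_triangle[of a p "axis_pt l"] dist_triangle[of p y "axis_pt l"]
      dist_triangle[of "axis_pt l" y "axis_pt k"] l_len by (simp add: dist_commute)
  moreover have "dist a y = dist (\<phi> g y) (axis_pt c)"
    by (simp add: a_def dist_act_left dist_commute)
  moreover have "dist (\<phi> g y) (axis_pt c) \<le> dist (\<phi> g y) (axis_pt 0)"
    using c by (simp only: nearest_def y_def)
  moreover have "dist (\<phi> g y) p \<le> dist p y + len g"
    using dist_triangle[of "\<phi> g y" p "\<phi> g p"] by (simp add: len_def dist_commute)
  moreover have "dist p (axis_pt c) \<le> dist a p + len g"
    using dist_triangle[of p "axis_pt c" "\<phi> g p"] dist_act_left[of "inv g" "axis_pt c" p]
    by (simp add: a_def len_def dist_commute)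
  ultimately show "len (h [^] c) \<le> \<tau>\<^sub>1"
    by (simp add: \<tau>\<^sub>1_def dist_p_axis_pt)
qed

text \<open>If \<^term>\<open>x\<close> projects far from the base point both on the axis and on its translate by
  \<^term>\<open>inv g\<close>, then a geodesic from \<^term>\<open>x\<close> would have to visit each axis before the other.\<close>

lemma proj_within_or_translate:
  "proj_within (B + D + 1) x \<or> proj_within (B + D + 1) (\<phi> g x)"
proof (rule ccontr)
  assume "\<not> ?thesis"
  then obtain k l where k: "nearest x k" "B + D + 1 < dist p (axis_pt k)"
    and l: "nearest (\<phi> g x) l" "B + D + 1 < dist p (axis_pt l)"
    by (auto simp: proj_within_def not_le dist_p_axis_pt)
  define z where "z = \<phi> (inv g) (axis_pt l)"
  obtain m where m: "nearest z m"
    using ex_nr by blast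
  have m_len: "dist p (axis_pt m) \<le> B"
    using proj_withinD[OF proj_inv_g m[unfolded z_def]] by (simp add: dist_p_axis_pt)
  have km: "D + 1 < dist (axis_pt k) (axis_pt m)"
    using dist_triangle2[of p "axis_pt k" "axis_pt m"] k m_len by simp
  then have "dist x (axis_pt k) + 1 < dist x z"
    using reverse_triangle[OF k(1) m] zero_le_dist[of "axis_pt m" z] by linarith
  obtain m' where m': "nearest (\<phi> g (axis_pt k)) m'"
    using ex_nr by blast
  have m'_len: "dist p (axis_pt m') \<le> B"
    using proj_withinD[OF proj_g m'] by (simp add: dist_p_axis_pt)
  have "D + 1 < dist (axis_pt l) (axis_pt m')"
    using dist_triangle2[of p "axis_pt l" "axis_pt m'"] l m'_len by simp
  then have "dist (\<phi> g x) (axis_pt l) + 1 < dist (\<phi> g x) (\<phi> g (axis_pt k))"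
    using reverse_triangle[OF l(1) m'] zero_le_dist[of "axis_pt m'" "\<phi> g (axis_pt k)"] by linarith
  then have "dist x z + 1 < dist x (axis_pt k)"
    by (simp add: z_def dist_act_left)
  then show False
    using \<open>dist x (axis_pt k) + 1 < dist x z\<close> by simp
qed

text \<open>Controls both ends of the segment from \<open>p\<close> to \<open>\<phi> b p\<close>:
  translated by \<open>b\<close>, the last condition says that \<open>p\<close> projects near
  \<open>\<phi> b p\<close> on the axis translated by \<open>b\<close>.\<close>

definition good :: "'a \<Rightarrow> bool" where
  "good b \<longleftrightarrow> b \<in> carrier G \<and> proj_within \<tau>\<^sub>0 (\<phi> b p) \<and> proj_within \<tau>\<^sub>0 (\<phi> (inv b) p)"

lemma good_proj: "\<lbrakk>good b; nearest (\<phi> b p) k\<rbrakk> \<Longrightarrow> dist p (axis_pt k) \<le> \<tau>\<^sub>0"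
  and good_inv_proj: "\<lbrakk>good b; nearest (\<phi> (inv b) p) k\<rbrakk> \<Longrightarrow> dist p (axis_pt k) \<le> \<tau>\<^sub>0"
  by (auto simp: good_def dist_p_axis_pt dest: proj_withinD)

text \<open>\<open>u\<close> corrects the projection of \<open>\<phi> b p\<close>, and
  \<open>inv v\<close> that of \<open>\<phi> (inv b) p\<close>. Each correction moves the other end
  by at most \<open>len g\<close>, which \<open>proj_within_nearby\<close> absorbs.\<close>

lemma ex_good_translate:
  assumes b: "b \<in> carrier G"
  shows "\<exists>u\<in>{\<one>, g}. \<exists>v\<in>{\<one>, inv g}. good (u \<otimes> b \<otimes> v)"
proof -
  obtain u where u: "u \<in> {\<one>, g}" "proj_within (B + D + 1) (\<phi> u (\<phi> b p))"
    using proj_within_or_translate[of "\<phi> b p"] by force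
  obtain v where v: "v \<in> {\<one>, inv g}" "proj_within (B + D + 1) (\<phi> (inv v) (\<phi> (inv b) p))"
    using proj_within_or_translate[of "\<phi> (inv b) p"] by force
  have uv: "u \<in> carrier G" "v \<in> carrier G" "len u \<le> len g" "len v \<le> len g"
    using u v by auto
  have "dist (\<phi> u (\<phi> b p)) (\<phi> (u \<otimes> b \<otimes> v) p) = len v"
    using uv b by (simp add: act_mult len_def)
  then have "proj_within \<tau>\<^sub>0 (\<phi> (u \<otimes> b \<otimes> v) p)"
    using proj_within_nearby[OF u(2), of "\<phi> (u \<otimes> b \<otimes> v) p"] uv
    by (elim proj_within_mono) (simp add: \<tau>\<^sub>0_def)
  moreover have "dist (\<phi> (inv v) (\<phi> (inv b) p)) (\<phi> (inv (u \<otimes> b \<otimes> v)) p) = len u"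
    using uv(1,2) b by (simp add: inv_mult_group act_mult flip: len_def)
  then have "proj_within \<tau>\<^sub>0 (\<phi> (inv (u \<otimes> b \<otimes> v)) p)"
    using proj_within_nearby[OF v(2), of "\<phi> (inv (u \<otimes> b \<otimes> v)) p"] uv
    by (elim proj_within_mono) (simp add: \<tau>\<^sub>0_def)
  ultimately show ?thesis
    using u v uv b by (auto simp: good_def)
qed

text \<open>The conjugate of \<^term>\<open>g\<close> inserted between the letters of a word: it stays in every normal subgroup
  containing \<^term>\<open>g\<close> and its two long powers follow two transverse axes.\<close>

definition link :: "int \<Rightarrow> 'a" where
  "link N = h [^] N \<otimes> g \<otimes> h [^] (- N)"

text \<open>One generous margin for all later uses: the ends of \<open>h [^] N\<close> stay
  \<open>D\<close> apart after projection errors, and cancelling a link gains more than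
  near-minimality allows.\<close>

definition long :: "int \<Rightarrow> bool" where
  "long N \<longleftrightarrow> 4 * (D + \<tau>\<^sub>0 + \<tau>\<^sub>1 + \<tau>\<^sub>2 + B + len g) < len (h [^] N)"

lemma ex_long: "\<exists>N. long N"
  using ex_large_pow unfolding long_def by blast

lemma link_closed [simp]: "link N \<in> carrier G"
  by (simp add: link_def)

lemma act_link: "\<phi> (link N) x = \<phi> (h [^] N) (\<phi> g (\<phi> (h [^] (- N)) x))"
  by (simp add: link_def act_mult)

lemma inv_link: "inv (link N) = h [^] N \<otimes> inv g \<otimes> h [^] (- N)"
  by (simp add: link_def inv_mult_group int_pow_neg m_assoc)

text \<open>\<open>h [^] (- N)\<close> makes the projection far from \<open>p\<close>, so after
  \<open>g\<close> it is within \<open>\<tau>\<^sub>1\<close> of \<open>p\<close>, and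
  \<open>h [^] N\<close> shifts it to \<open>axis_pt N\<close>.\<close>

lemma nearest_link:
  assumes N: "long N" and x: "proj_within \<tau> x" "\<tau> \<le> \<tau>\<^sub>2" and k: "nearest (\<phi> (link N) x) k"
  shows "dist (axis_pt N) (axis_pt k) \<le> \<tau>\<^sub>1"
proof -
  have "proj_within \<tau>\<^sub>1 (\<phi> g (\<phi> (h [^] (- N)) x))"
  proof (rule proj_within_transverse[OF x(1)])
    show "D + \<tau> + B \<le> len (h [^] (- N))"
      using N x(2) \<tau>_nonneg B_nonneg D_nonneg len_nonneg[of g] unfolding long_def len_pow_minus
      by argo
  qed
  then show ?thesis
    using k by (auto simp: act_link nearest_act_pow dist_axis_pt dest: proj_withinD)
qed

lemma nearest_inv_link:
  assumes "long N" "proj_within \<tau> x" "\<tau> \<le> \<tau>\<^sub>2" "nearest (\<phi> (inv (link N)) x) k"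
  shows "dist (axis_pt N) (axis_pt k) \<le> \<tau>\<^sub>1"
proof -
  \<comment> \<open>The inverse of the link is the link of \<open>inv g\<close>, and the radii agree
    because \<open>len (inv g) = len g\<close>.\<close>
  interpret inv: transverse_axis G \<phi> p h D "inv g" B
    by (rule transverse_inv)
  have \<tau>: "inv.\<tau>\<^sub>0 = \<tau>\<^sub>0" "inv.\<tau>\<^sub>1 = \<tau>\<^sub>1" "inv.\<tau>\<^sub>2 = \<tau>\<^sub>2"
    by (simp_all add: inv.\<tau>\<^sub>0_def inv.\<tau>\<^sub>1_def inv.\<tau>\<^sub>2_def \<tau>\<^sub>0_def \<tau>\<^sub>1_def \<tau>\<^sub>2_def)
  show ?thesis
    using inv.nearest_link[of N \<tau> x k] assms by (simp add: inv.long_def long_def \<tau> inv.link_def inv_link)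
qed

text \<open>After translation by \<open>inv b\<close> the start projects near \<open>p\<close> and
  the end near \<open>axis_pt N\<close>, so the way between them passes near \<open>p\<close>, the
  translate of \<open>\<phi> b p\<close>.\<close>

lemma word_aligned:
  assumes N: "long N" and b: "good b" and x: "proj_within \<tau>\<^sub>2 x"
  shows "len b + dist (\<phi> b p) (\<phi> (b \<otimes> link N) x) \<le> dist p (\<phi> (b \<otimes> link N) x) + 2 * \<tau>\<^sub>0 + D"
proof -
  define y where "y = \<phi> (link N) x"
  define q where "q = \<phi> (inv b) p"
  have bc: "b \<in> carrier G"
    using b by (simp add: good_def)
  obtain k l where k: "nearest q k" and l: "nearest y l"
    using ex_nr by blast
  have k_len: "dist p (axis_pt k) \<le> \<tau>\<^sub>0"
    using good_inv_proj b k by (simp add: q_def)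
  have "dist (axis_pt N) (axis_pt l) \<le> \<tau>\<^sub>1"
    using nearest_link[OF N x order_refl] l by (simp add: y_def)
  then have "D \<le> dist (axis_pt k) (axis_pt l)"
    using N k_len dist_triangle[of p "axis_pt N" "axis_pt k"] dist_triangle2[of "axis_pt k" "axis_pt N" "axis_pt l"]
      \<tau>_nonneg B_nonneg D_nonneg len_nonneg[of g] unfolding long_def dist_p_axis_pt by argo
  from reverse_triangle[OF k l this] have "dist q p + dist p y \<le> dist q y + 2 * \<tau>\<^sub>0 + D"
    using k_len dist_triangle[of q p "axis_pt k"] dist_triangle[of p y "axis_pt k"]
      dist_triangle[of "axis_pt k" y "axis_pt l"] by (simp add: dist_commute)
  moreover have "dist q p = len b" "dist q y = dist p (\<phi> b y)"
    using bc by (simp_all add: q_def dist_act_left len_def)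
  ultimately show ?thesis
    using bc by (simp add: y_def act_mult)
qed

text \<open>If \<open>z\<close> projected far from \<open>p\<close>, the path from
  \<open>\<phi> b p\<close> to \<open>z\<close> would pass near \<open>p\<close>; by
  \<open>word_aligned\<close> the path from \<open>p\<close> to \<open>z\<close> passes near
  \<open>\<phi> b p\<close>. Both together force
  \<open>len b \<le> 2 * \<tau>\<^sub>0 + D\<close>.\<close>

lemma proj_within_word_step:
  assumes N: "long N" and b: "good b" "2 * \<tau>\<^sub>0 + D < len b" and x: "proj_within \<tau>\<^sub>2 x"
  shows "proj_within \<tau>\<^sub>2 (\<phi> (b \<otimes> link N) x)"
  unfolding proj_within_def
proof (intro allI impI, rule ccontr)
  fix c
  define z where "z = \<phi> (b \<otimes> link N) x"
  assume c: "nearest (\<phi> (b \<otimes> link N) x) c" and "\<not> len (h [^] c) \<le> \<tau>\<^sub>2"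
  then have c_far: "\<tau>\<^sub>0 + D < dist p (axis_pt c)"
    by (simp add: \<tau>\<^sub>2_def dist_p_axis_pt)
  obtain k where k: "nearest (\<phi> b p) k"
    using ex_nr by blast
  have k_len: "dist p (axis_pt k) \<le> \<tau>\<^sub>0"
    using good_proj b k by simp
  have "D \<le> dist (axis_pt k) (axis_pt c)"
    using c_far k_len dist_triangle[of p "axis_pt c" "axis_pt k"] by simp
  from reverse_triangle[OF k c[folded z_def] this]
  have "len b + dist p z \<le> dist (\<phi> b p) z + 2 * \<tau>\<^sub>0 + D"
    using k_len dist_triangle[of p "\<phi> b p" "axis_pt k"] dist_triangle[of p z "axis_pt k"]
      dist_triangle[of "axis_pt k" z "axis_pt c"] by (simp add: dist_commute len_def)
  then show False
    using word_aligned[OF N b(1) x] b(2) by (simp add: z_def)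
qed

text \<open>The translate of the axis through \<^term>\<open>\<phi> (b \<otimes> link N) p\<close> separates: if \<^term>\<open>\<phi> b' p\<close> projected
  near that point, the path to it would contain a copy of the link which can be cancelled,
  contradicting \<open>min\<close>.\<close>

lemma word_separation_aux:
  assumes N: "long N" and b: "good b" and b': "good b'" and le: "len b \<le> len b'"
    and min: "len b' \<le> len (b \<otimes> inv (link N) \<otimes> inv b \<otimes> b') + 2 * len g"
    and x: "proj_within \<tau>\<^sub>2 x" and x': "proj_within \<tau>\<^sub>2 x'"
    and eq: "\<phi> (b \<otimes> link N) x = \<phi> (b' \<otimes> link N) x'"
  shows "len (inv (b \<otimes> link N) \<otimes> b') \<le> len (link N) + 2 * \<tau>\<^sub>0 + 2 * D + 2 * \<tau>\<^sub>2"
proof -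
  define f where "f = link N"
  \<comment> \<open>Translation by \<open>t\<close> moves \<open>\<phi> (b \<otimes> f) p\<close> to
    \<open>p\<close>. In these coordinates both words start at \<open>P\<close> and end at
    \<open>x\<close>, and \<open>Y\<close> is the end of the rival letter \<open>b'\<close>.\<close>
  define t where "t = inv (b \<otimes> f)"
  define P where "P = \<phi> t p"
  define Y where "Y = \<phi> t (\<phi> b' p)"
  have bc: "b \<in> carrier G" "b' \<in> carrier G" and fc [simp]: "f \<in> carrier G"
    using b b' by (simp_all add: good_def f_def)
  then have tc: "t \<in> carrier G"
    by (simp add: t_def)
  have x_eq: "x = \<phi> t (\<phi> (b' \<otimes> f) x')"
    using eq bc by (simp add: t_def flip: f_def) (metis act_inv_act fc m_closed)
  have PY: "dist P Y = len b'"
    using tc by (simp add: P_def Y_def len_def)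
  have Yx: "dist Y x = dist (\<phi> b' p) (\<phi> (b' \<otimes> f) x')"
    using tc by (simp add: x_eq Y_def)
  have Px: "dist P x = dist p (\<phi> (b' \<otimes> f) x')"
    using tc by (simp add: x_eq P_def)
  have aligned: "dist P Y + dist Y x \<le> dist P x + 2 * \<tau>\<^sub>0 + D"
    using word_aligned[OF N b' x'] by (simp add: PY Yx Px f_def)
  have pY: "dist p Y = len (t \<otimes> b')"
    using tc bc by (simp add: Y_def len_def act_mult)
  obtain kP kx l where kP: "nearest P kP" and kx: "nearest x kx" and l: "nearest Y l"
    using ex_nr by blast
  have P_eq: "P = \<phi> (inv f) (\<phi> (inv b) p)"
    using bc by (simp add: P_def t_def inv_mult_group act_mult)
  have kP_len: "dist (axis_pt N) (axis_pt kP) \<le> \<tau>\<^sub>1"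
    using nearest_inv_link[OF N, of \<tau>\<^sub>0 "\<phi> (inv b) p" kP] kP b D_nonneg
    by (simp add: P_eq f_def good_def \<tau>\<^sub>2_def)
  have kx_len: "dist p (axis_pt kx) \<le> \<tau>\<^sub>2"
    using proj_withinD[OF x kx] by (simp add: dist_p_axis_pt)
  have N': "4 * (D + \<tau>\<^sub>0 + \<tau>\<^sub>1 + \<tau>\<^sub>2 + B + len g) < dist p (axis_pt N)"
    using N by (simp add: long_def dist_p_axis_pt)
  \<comment> \<open>If \<open>Y\<close> projected near \<open>p\<close>, the path from
    \<open>P\<close> to \<open>Y\<close> would pass near \<open>axis_pt N\<close> and then
    \<open>p\<close>, hence follow the link. Facts 1, 2 and 3 show that cutting the link out saves
    about \<open>2 * dist p (axis_pt N)\<close>, against \<open>min\<close>.\<close>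
  have "\<not> dist p (axis_pt l) \<le> D + \<tau>\<^sub>2"
  proof
    assume l_len: "dist p (axis_pt l) \<le> D + \<tau>\<^sub>2"
    have kPl: "dist p (axis_pt N) - \<tau>\<^sub>1 - D - \<tau>\<^sub>2 \<le> dist (axis_pt kP) (axis_pt l)"
      using l_len kP_len dist_triangle[of p "axis_pt N" "axis_pt l"] dist_triangle2[of "axis_pt l" "axis_pt N" "axis_pt kP"]
      by (simp add: dist_commute)
    have "D \<le> dist (axis_pt kP) (axis_pt l)"
      using kPl N' \<tau>_nonneg B_nonneg D_nonneg len_nonneg[of g] by argo
    from reverse_triangle[OF kP l this]
    have 1: "dist P (axis_pt N) + dist p (axis_pt N) + dist p Y \<le> len b' + 2 * \<tau>\<^sub>1 + 3 * D + 2 * \<tau>\<^sub>2"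
      using kPl kP_len l_len dist_triangle[of P "axis_pt N" "axis_pt kP"] dist_triangle[of p Y "axis_pt l"]
      by (simp add: PY dist_commute)
    define q where "q = \<phi> (inv b) p"
    obtain k where k: "nearest q k"
      using ex_nr by blast
    have k_len: "dist p (axis_pt k) \<le> \<tau>\<^sub>0"
      using good_inv_proj b k by (simp add: q_def)
    have "D \<le> dist (axis_pt k) (axis_pt N)"
      using k_len N' dist_triangle[of p "axis_pt N" "axis_pt k"] \<tau>_nonneg B_nonneg D_nonneg len_nonneg[of g]
      by argo
    then have 2: "len b + dist p (axis_pt N) \<le> dist q (axis_pt N) + 2 * \<tau>\<^sub>0 + D"
    proof -
      have "dist q p = len b"
        using bc by (simp add: q_def dist_act_left len_def)
      with reverse_triangle[OF k nearest_axis_pt \<open>D \<le> dist (axis_pt k) (axis_pt N)\<close>] show ?thesis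
        using k_len dist_triangle[of q p "axis_pt k"] dist_triangle[of p "axis_pt N" "axis_pt k"]
        by (simp add: dist_commute)
    qed
    have "dist P (axis_pt N) = dist (\<phi> (h [^] (- N)) q) (\<phi> g p)"
      by (simp add: P_eq q_def f_def inv_link act_mult axis_pt_def dist_act_left int_pow_neg)
    moreover have "dist (\<phi> (h [^] (- N)) q) p = dist q (axis_pt N)"
      by (simp add: axis_pt_def dist_act_left int_pow_neg)
    ultimately have 3: "dist q (axis_pt N) \<le> dist P (axis_pt N) + len g"
      using dist_triangle2[of "\<phi> (h [^] (- N)) q" p "\<phi> g p"] by (simp add: len_def)
    have "len (b \<otimes> inv f \<otimes> inv b \<otimes> b') \<le> len b + len (t \<otimes> b')"
      using len_mult[of b "t \<otimes> b'"] bc by (simp add: t_def inv_mult_group m_assoc)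
    then show False
      using 1 2 3 min N' \<tau>_nonneg B_nonneg D_nonneg len_nonneg[of g]
      unfolding pY f_def[symmetric] by argo
  qed
  \<comment> \<open>Now the path from \<open>Y\<close> to \<open>x\<close> passes near
    \<open>p\<close>. By \<open>aligned\<close> the path from \<open>P\<close> to \<open>x\<close>
    passes near \<open>Y\<close>; since \<open>P\<close> is at most \<open>len b + len f\<close>
    from \<open>p\<close> and at least \<open>len b\<close> from \<open>Y\<close>, the point
    \<open>Y\<close> is close to \<open>p\<close>.\<close>
  then have far: "D \<le> dist (axis_pt l) (axis_pt kx)"
    using kx_len dist_triangle2[of p "axis_pt l" "axis_pt kx"] by simp
  have "dist p Y + dist p x - 2 * \<tau>\<^sub>2 - D \<le> dist Y x"
    using reverse_triangle[OF l kx far] kx_len dist_triangle[of p Y "axis_pt kx"]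
      dist_triangle[of p x "axis_pt kx"] dist_triangle[of "axis_pt kx" Y "axis_pt l"]
    by (simp add: dist_commute)
  moreover have "dist P p \<le> len b + len f"
  proof -
    have "dist P p = len (b \<otimes> f)"
      using bc by (simp add: P_def t_def dist_act_left len_def)
    then show ?thesis
      using len_mult[of b f] bc by simp
  qed
  ultimately have "dist p Y \<le> len f + 2 * \<tau>\<^sub>0 + 2 * D + 2 * \<tau>\<^sub>2"
    using aligned le PY dist_triangle[of P x p] by simp
  then show ?thesis
    by (simp add: pY t_def f_def)
qed

end

section \<open>Counting words\<close>

lemma Limsup_lnD:
  assumes "exponential_growth_rate N < ereal s"
  shows "\<exists>r\<^sub>0>0. \<forall>r\<ge>r\<^sub>0. real (N r) \<le> exp (s * r)"
proof -
  have "eventually (\<lambda>r. ereal (1 / r * ln (real (N r))) < ereal s) at_top"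
    using assms unfolding exponential_growth_rate_def by (rule Limsup_lessD)
  then obtain r\<^sub>0 where r\<^sub>0: "\<And>r. r \<ge> r\<^sub>0 \<Longrightarrow> 1 / r * ln (real (N r)) < s"
    by (auto simp: eventually_at_top_linorder)
  have "real (N r) \<le> exp (s * r)" if "r \<ge> max 1 r\<^sub>0" for r
  \<comment> \<open>\<open>ln 0 = 0\<close>, so an empty count is treated apart.\<close>
  proof (cases "N r = 0")
    case False
    have "ln (real (N r)) < s * r"
      using r\<^sub>0[of r] that by (simp add: field_simps)
    then show ?thesis
      using False by (metis exp_less_cancel_iff exp_ln less_eq_real_def of_nat_0_less_iff zero_less_iff_neq_zero)
  qed simp
  then show ?thesis
    by (intro exI[of _ "max 1 r\<^sub>0"]) auto
qed

text \<open>A finite sum is continuous in the rate. The cap \<open>\<delta> + 1\<close> bounds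
  constants that depend on \<open>s\<close>, so the finite set can be chosen before
  \<open>s\<close>.\<close>

lemma exp_sum_increase_rate:
  fixes a :: "'a \<Rightarrow> real"
  assumes "K < (\<Sum>x\<in>F. exp (- \<delta> * a x))"
  shows "\<exists>s>\<delta>. s < \<delta> + 1 \<and> K < (\<Sum>x\<in>F. exp (- s * a x))"
proof -
  have "((\<lambda>s. \<Sum>x\<in>F. exp (- s * a x)) \<longlongrightarrow> (\<Sum>x\<in>F. exp (- \<delta> * a x))) (at_right \<delta>)"
    by (intro tendsto_intros)
  then have "eventually (\<lambda>s. K < (\<Sum>x\<in>F. exp (- s * a x))) (at_right \<delta>)"
    using assms by (rule order_tendstoD)
  moreover have "eventually (\<lambda>s. s \<in> {\<delta><..<\<delta> + 1}) (at_right \<delta>)"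
    by (rule eventually_at_right_real) simp
  ultimately have "eventually (\<lambda>s. s > \<delta> \<and> s < \<delta> + 1 \<and> K < (\<Sum>x\<in>F. exp (- s * a x))) (at_right \<delta>)"
    by eventually_elim simp
  then show ?thesis
    by (rule eventually_happens'[rotated]) simp
qed

section \<open>Poincare series of the group and of sets of words\<close>

context isometry_group
begin

text \<open>Growth below \<open>s' < s\<close> would bound all finite parts of the series: elements
  up to length \<open>r\<^sub>0\<close> contribute at most 1 each, and the others, grouped by
  integer part of the length, are dominated by a geometric series of ratio \<open>x\<close>.\<close>

lemma growth_exponent_geI:
  assumes s: "0 \<le> s"
    and unbounded: "\<And>K. \<exists>F. finite F \<and> F \<subseteq> carrier G \<and> K < (\<Sum>g\<in>F. exp (- s * len g))"
  shows "ereal s \<le> growth_exponent G \<phi> p"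
proof (rule ccontr)
  define N where "N r = card {g \<in> carrier G. len g \<le> r}" for r
  assume "\<not> ?thesis"
  then have "exponential_growth_rate N < ereal s"
    by (simp add: growth_exponent_def N_def[abs_def] len_def)
  then obtain s' where s': "exponential_growth_rate N < ereal s'" "s' < s"
    using ereal_dense2 by fastforce
  obtain r\<^sub>0 where r\<^sub>0: "0 < r\<^sub>0" "\<And>r. r \<ge> r\<^sub>0 \<Longrightarrow> real (N r) \<le> exp (s' * r)"
    using Limsup_lnD[OF s'(1)] by blast
  define x where "x = exp (s' - s)"
  have x: "0 < x" "x < 1"
    using s' by (simp_all add: x_def)
  define K where "K = real (N r\<^sub>0) + exp s' * (1 / (1 - x))"
  obtain F where F: "finite F" "F \<subseteq> carrier G" "K < (\<Sum>g\<in>F. exp (- s * len g))"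
    using unbounded by blast
  define F1 F2 where "F1 = {g \<in> F. len g \<le> r\<^sub>0}" and "F2 = {g \<in> F. r\<^sub>0 < len g}"
  have "finite F1" "finite F2"
    using F(1) by (simp_all add: F1_def F2_def)
  have F_eq: "F1 \<union> F2 = F"
    unfolding F1_def F2_def by (rule Set.set_eqI) (simp add: linorder_le_less_linear flip: conj_disj_distribL)
  have "F1 \<inter> F2 = {}"
    unfolding F1_def F2_def by (rule Set.set_eqI) simp
  then have split: "(\<Sum>g\<in>F. exp (- s * len g)) = (\<Sum>g\<in>F1. exp (- s * len g)) + (\<Sum>g\<in>F2. exp (- s * len g))"
    using sum.union_disjoint[OF \<open>finite F1\<close> \<open>finite F2\<close>] F_eq by metis
  have "(\<Sum>g\<in>F1. exp (- s * len g)) \<le> (\<Sum>g\<in>F1. 1)"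
    using s by (intro sum_mono) simp
  also have "\<dots> \<le> real (N r\<^sub>0)"
  proof -
    have "card F1 \<le> N r\<^sub>0"
      unfolding N_def by (rule card_mono[OF finite_len_le]) (use F(2) in \<open>auto simp: F1_def\<close>)
    then show ?thesis
      by simp
  qed
  finally have 1: "(\<Sum>g\<in>F1. exp (- s * len g)) \<le> real (N r\<^sub>0)" .
  define fl where "fl g = nat \<lfloor>len g\<rfloor>" for g
  have fl: "real (fl g) \<le> len g" "len g \<le> real (fl g) + 1" for g
    using len_nonneg[of g] by (simp_all add: fl_def)
  have level: "(\<Sum>g\<in>{g \<in> F2. fl g = n}. exp (- s * len g)) \<le> exp s' * x ^ n" if n: "n \<in> fl ` F2" for n
  proof -
    have "(\<Sum>g\<in>{g \<in> F2. fl g = n}. exp (- s * len g)) \<le> (\<Sum>g\<in>{g \<in> F2. fl g = n}. exp (- s * real n))"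
      using s fl by (intro sum_mono) (auto intro: mult_left_mono)
    also have "\<dots> = real (card {g \<in> F2. fl g = n}) * exp (- s * real n)"
      by simp
    also have "\<dots> \<le> real (N (real n + 1)) * exp (- s * real n)"
    proof -
      have "{g \<in> F2. fl g = n} \<subseteq> {g \<in> carrier G. len g \<le> real n + 1}"
        using F(2) fl(2) by (auto simp: F2_def)
      then have "card {g \<in> F2. fl g = n} \<le> N (real n + 1)"
        unfolding N_def by (rule card_mono[OF finite_len_le])
      then show ?thesis
        by (intro mult_right_mono) simp_all
    qed
    also have "\<dots> \<le> exp (s' * (real n + 1)) * exp (- s * real n)"
    proof -
      obtain g where "g \<in> F2" "fl g = n"
        using n by blast
      then have "r\<^sub>0 \<le> real n + 1"
        using fl(2)[of g] by (simp add: F2_def)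
      then show ?thesis
        using r\<^sub>0(2) by (intro mult_right_mono) auto
    qed
    also have "\<dots> = exp s' * x ^ n"
      by (simp add: x_def exp_of_nat_mult[symmetric] algebra_simps flip: exp_add)
    finally show ?thesis .
  qed
  have "(\<Sum>g\<in>F2. exp (- s * len g)) = (\<Sum>n\<in>fl ` F2. \<Sum>g\<in>{g \<in> F2. fl g = n}. exp (- s * len g))"
    using \<open>finite F2\<close> by (rule sum.image_gen)
  also have "\<dots> \<le> (\<Sum>n\<in>fl ` F2. exp s' * x ^ n)"
    by (intro sum_mono level)
  also have "\<dots> = exp s' * (\<Sum>n\<in>fl ` F2. x ^ n)"
    by (simp add: sum_distrib_left)
  also have "\<dots> \<le> exp s' * (1 / (1 - x))"
  proof -
    have "(\<Sum>n\<in>fl ` F2. x ^ n) \<le> suminf (\<lambda>n. x ^ n)"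
      using x \<open>finite F2\<close> by (intro sum_le_suminf summable_geometric) auto
    also have "\<dots> = 1 / (1 - x)"
      using x by (intro suminf_geometric) simp
    finally show ?thesis
      by (intro mult_left_mono) simp_all
  qed
  finally show False
    using 1 F(3) split by (simp add: K_def)
qed

text \<open>As \<open>len\<close> is subadditive, weights of products dominate products of weights.
  The fibres of multiplication have at most \<open>M\<close> elements: \<open>sep\<close> leaves
  \<open>M\<close> choices for the first letter, which determines the rest.\<close>

lemma words_weight:
  assumes E: "finite E" "E \<subseteq> carrier G" and s: "0 \<le> s"
    and sep: "\<And>n e e' V V'. \<lbrakk>e \<in> E; e' \<in> E; V \<in> words E n; V' \<in> words E n; e \<otimes> V = e' \<otimes> V'\<rbrakk>
      \<Longrightarrow> len (inv e \<otimes> e') \<le> R"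
  defines "M \<equiv> card {g \<in> carrier G. len g \<le> R}"
  shows "(\<Sum>e\<in>E. exp (- s * len e)) ^ n \<le> real M ^ n * (\<Sum>W\<in>words E n. exp (- s * len W))"
proof (induction n)
  case 0
  then show ?case
    by simp
next
  case (Suc n)
  let ?S = "\<Sum>e\<in>E. exp (- s * len e)"
  let ?Q = "\<lambda>n. \<Sum>W\<in>words E n. exp (- s * len W)"
  define mul where "mul = (\<lambda>(e, V). e \<otimes> V)"
  let ?P = "E \<times> words E n"
  have finP: "finite ?P"
    using E finite_words by simp
  have fibre: "card {x \<in> ?P. mul x = W} \<le> M" if W: "W \<in> mul ` ?P" for W
  proof -
    obtain e0 V0 where e0: "e0 \<in> E" "V0 \<in> words E n" "W = e0 \<otimes> V0"
      using W by (auto simp: mul_def)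
    show ?thesis
      unfolding M_def
    proof (rule card_inj_on_le[where f = "\<lambda>x. inv e0 \<otimes> fst x"])
      show "inj_on (\<lambda>x. inv e0 \<otimes> fst x) {x \<in> ?P. mul x = W}"
      proof (rule inj_onI)
        fix x y
        assume x: "x \<in> {x \<in> ?P. mul x = W}" and y: "y \<in> {x \<in> ?P. mul x = W}"
          and eq: "inv e0 \<otimes> fst x = inv e0 \<otimes> fst y"
        have "e0 \<in> carrier G" "fst x \<in> carrier G" "snd x \<in> carrier G" "fst y \<in> carrier G"
          "snd y \<in> carrier G"
          using x y e0 E(2) words_closed[OF E(2)] by auto
        moreover have "fst x \<otimes> snd x = fst y \<otimes> snd y"
          using x y by (simp add: mul_def case_prod_beta)
        ultimately show "x = y"
          using eq by (simp add: prod_eq_iff)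
      qed
      show "(\<lambda>x. inv e0 \<otimes> fst x) ` {x \<in> ?P. mul x = W} \<subseteq> {g \<in> carrier G. len g \<le> R}"
      proof
        fix y assume "y \<in> (\<lambda>x. inv e0 \<otimes> fst x) ` {x \<in> ?P. mul x = W}"
        then obtain e V where *: "e \<in> E" "V \<in> words E n" "e0 \<otimes> V0 = e \<otimes> V" "y = inv e0 \<otimes> e"
          using e0 by (auto simp: mul_def)
        have "e0 \<in> carrier G" "e \<in> carrier G"
          using e0 * E(2) by auto
        then show "y \<in> {g \<in> carrier G. len g \<le> R}"
          using sep[OF e0(1) *(1) e0(2) *(2,3)] by (simp add: *(4))
      qed
    qed (rule finite_len_le)
  qed
  have "?S ^ Suc n = ?S * ?S ^ n"
    by simp
  also have "\<dots> \<le> ?S * (real M ^ n * ?Q n)"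
    by (intro mult_left_mono Suc.IH sum_nonneg) simp
  also have "\<dots> = real M ^ n * (\<Sum>(e, V)\<in>?P. exp (- s * len e) * exp (- s * len V))"
    by (simp add: sum_product sum.cartesian_product)
  also have "\<dots> \<le> real M ^ n * (\<Sum>x\<in>?P. exp (- s * len (mul x)))"
  proof (intro mult_left_mono sum_mono)
    fix x assume "x \<in> ?P"
    then obtain e V where x: "x = (e, V)" "e \<in> carrier G" "V \<in> carrier G"
      using E words_closed by blast
    have "s * len (e \<otimes> V) \<le> s * (len e + len V)"
      using s x by (intro mult_left_mono len_mult)
    then show "(case x of (e, V) \<Rightarrow> exp (- s * len e) * exp (- s * len V)) \<le> exp (- s * len (mul x))"
      using x by (simp add: mul_def distrib_left flip: exp_add)
  qed simp
  also have "(\<Sum>x\<in>?P. exp (- s * len (mul x))) = (\<Sum>W\<in>mul ` ?P. \<Sum>x\<in>{x \<in> ?P. mul x = W}. exp (- s * len (mul x)))"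
    by (rule sum.image_gen[OF finP])
  also have "\<dots> = (\<Sum>W\<in>mul ` ?P. real (card {x \<in> ?P. mul x = W}) * exp (- s * len W))"
    by simp
  also have "real M ^ n * \<dots> \<le> real M ^ n * (\<Sum>W\<in>mul ` ?P. real M * exp (- s * len W))"
    using fibre by (intro mult_left_mono sum_mono mult_right_mono) auto
  also have "\<dots> = real M ^ Suc n * ?Q (Suc n)"
    by (simp add: mul_def sum_distrib_left mult_ac)
  finally show ?case .
qed

lemma growth_exponent_ge_words:
  assumes E: "finite E" "E \<subseteq> carrier G" and s: "0 \<le> s"
    and sep: "\<And>n e e' V V'. \<lbrakk>e \<in> E; e' \<in> E; V \<in> words E n; V' \<in> words E n; e \<otimes> V = e' \<otimes> V'\<rbrakk>
      \<Longrightarrow> len (inv e \<otimes> e') \<le> R"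
    and large: "real (card {g \<in> carrier G. len g \<le> R}) < (\<Sum>e\<in>E. exp (- s * len e))"
  shows "ereal s \<le> growth_exponent G \<phi> p"
proof (rule growth_exponent_geI[OF s])
  fix K
  define M where "M = real (card {g \<in> carrier G. len g \<le> R})"
  define S where "S = (\<Sum>e\<in>E. exp (- s * len e))"
  have weight: "S ^ n \<le> M ^ n * (\<Sum>W\<in>words E n. exp (- s * len W))" for n
    unfolding S_def M_def by (rule words_weight[OF E s sep])
  have "M < S"
    using large by (simp add: M_def S_def)
  have "0 \<le> M"
    by (simp add: M_def)
  \<comment> \<open>For \<open>M = 0\<close> the case of words of length 1 would force
    \<open>S \<le> 0\<close>.\<close>
  moreover have "M \<noteq> 0"
    using weight[of 1] \<open>M < S\<close> by auto
  ultimately have "0 < M"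
    by simp
  then have "1 < S / M"
    using \<open>M < S\<close> by simp
  then obtain n where "K < (S / M) ^ n"
    using real_arch_pow by blast
  also have "\<dots> \<le> (\<Sum>W\<in>words E n. exp (- s * len W))"
    using weight[of n] \<open>0 < M\<close> by (simp add: power_divide field_simps)
  finally show "\<exists>F. finite F \<and> F \<subseteq> carrier G \<and> K < (\<Sum>g\<in>F. exp (- s * len g))"
    using finite_words[OF E(1)] words_closed[OF E(2)] by blast
qed

end

section \<open>The counting criterion applied to words with transverse elements\<close>

context transverse_axis
begin

text \<open>At rate 0 the weight of an alphabet is its size, so \<open>M + 1\<close> letters
  \<open>g \<otimes> h [^] k\<close> exceed \<open>M\<close>, and the rate can be raised a little.
  The letter is recovered because removing \<open>g\<close> from a product leaves a point projecting
  within \<open>\<tau>\<^sub>1\<close> of \<open>axis_pt k\<close>.\<close>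

lemma positive_growth: "\<exists>s>0. ereal s \<le> growth_exponent G \<phi> p"
proof -
  define M where "M = card {x \<in> carrier G. len x \<le> 2 * \<tau>\<^sub>1}"
  define L where "L = D + \<tau>\<^sub>1 + B"
  have "infinite {k::int. L \<le> len (h [^] k)}"
  proof
    assume "finite {k::int. L \<le> len (h [^] k)}"
    then have "finite ({k::int. L \<le> len (h [^] k)} \<union> {k. len (h [^] k) \<le> L})"
      using finite_pow by simp
    also have "{k::int. L \<le> len (h [^] k)} \<union> {k. len (h [^] k) \<le> L} = UNIV"
      by auto
    finally show False
      by simp
  qed
  then obtain I :: "int set" where I: "finite I" "card I = Suc M" "\<And>k. k \<in> I \<Longrightarrow> L \<le> len (h [^] k)"
    using infinite_arbitrarily_large[of "{k::int. L \<le> len (h [^] k)}" "Suc M"] by blast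
  define E where "E = (\<lambda>k. g \<otimes> h [^] k) ` I"
  have "inj_on (\<lambda>k. g \<otimes> h [^] k) I"
    by (rule inj_onI) (simp add: pow_eq_iff)
  then have "card E = Suc M"
    using I by (simp add: E_def card_image)
  then have K: "real M < (\<Sum>e\<in>E. exp (- 0 * len e))"
    by simp
  then obtain s where s: "0 < s" "real M < (\<Sum>e\<in>E. exp (- s * len e))"
    using exp_sum_increase_rate[OF K] by auto
  have near: "proj_within \<tau>\<^sub>1 (\<phi> V p)" if "V \<in> words E n" for V n
    using that
  proof (induction n arbitrary: V)
    case 0
    then show ?case
      using \<tau>_nonneg by (simp add: proj_within_base)
  next
    case (Suc n)
    then obtain k V' where k: "k \<in> I" and V': "V' \<in> words E n" "V = g \<otimes> h [^] k \<otimes> V'"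
      by (auto simp: E_def)
    have "E \<subseteq> carrier G"
      by (auto simp: E_def)
    then have "V' \<in> carrier G"
      using V' words_closed by blast
    then have "\<phi> V p = \<phi> g (\<phi> (h [^] k) (\<phi> V' p))"
      by (simp add: V' act_mult)
    then show ?case
      using proj_within_transverse[OF Suc.IH[OF V'(1)], of k] I(3)[OF k] by (simp add: L_def)
  qed
  have "ereal s \<le> growth_exponent G \<phi> p"
  proof (rule growth_exponent_ge_words)
    show "finite E" "E \<subseteq> carrier G" "0 \<le> s"
      using I s by (auto simp: E_def)
    show "real (card {x \<in> carrier G. len x \<le> 2 * \<tau>\<^sub>1}) < (\<Sum>e\<in>E. exp (- s * len e))"
      using s by (simp add: M_def)
    fix n e e' V V'
    assume *: "e \<in> E" "e' \<in> E" "V \<in> words E n" "V' \<in> words E n" "e \<otimes> V = e' \<otimes> V'"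
    obtain k :: int where "e = g \<otimes> h [^] k"
      using *(1) unfolding E_def by (rule imageE)
    moreover obtain k' :: int where "e' = g \<otimes> h [^] k'"
      using *(2) unfolding E_def by (rule imageE)
    ultimately have k: "e = g \<otimes> h [^] k" "e' = g \<otimes> h [^] k'"
      by simp_all
    have V: "V \<in> carrier G" "V' \<in> carrier G"
      using * words_closed \<open>E \<subseteq> carrier G\<close> by blast+
    have "h [^] k \<otimes> V = h [^] k' \<otimes> V'"
      using * k V by (simp add: m_assoc)
    then have eq: "\<phi> (h [^] k) (\<phi> V p) = \<phi> (h [^] k') (\<phi> V' p)"
      using V by (metis act_mult h_closed int_pow_closed)
    obtain l where l: "nearest (\<phi> (h [^] k) (\<phi> V p)) l"
      using ex_nr by blast
    have "dist (axis_pt k) (axis_pt l) \<le> \<tau>\<^sub>1"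
      using proj_withinD[OF near[OF *(3)], of "l - k"] l by (simp add: nearest_act_pow dist_axis_pt)
    moreover have "dist (axis_pt k') (axis_pt l) \<le> \<tau>\<^sub>1"
      using proj_withinD[OF near[OF *(4)], of "l - k'"] l by (simp add: eq nearest_act_pow dist_axis_pt)
    moreover have "inv e \<otimes> e' = h [^] (k' - k)"
      by (simp add: k inv_mult_group m_assoc int_pow_mult int_pow_neg flip: minus_add_distrib
          int_pow_mult) (simp add: m_assoc[symmetric] int_pow_neg[symmetric] flip: int_pow_mult)
    ultimately show "len (inv e \<otimes> e') \<le> 2 * \<tau>\<^sub>1"
      using dist_triangle2[of "axis_pt k" "axis_pt k'" "axis_pt l"] by (simp add: dist_axis_pt)
  qed
  then show ?thesis
    using s by blast
qed

text \<open>One \<open>len (link N)\<close> comes from \<open>word_separation_aux\<close>, the other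
  from appending the link to the second letter.\<close>

definition sep :: "int \<Rightarrow> real" where
  "sep N = 2 * len (link N) + 2 * \<tau>\<^sub>0 + 2 * D + 2 * \<tau>\<^sub>2"

lemma word_separation:
  assumes N: "long N" and b: "good b" and b': "good b'"
    and min: "len b' \<le> len (b \<otimes> inv (link N) \<otimes> inv b \<otimes> b') + 2 * len g"
    and min': "len b \<le> len (b' \<otimes> inv (link N) \<otimes> inv b' \<otimes> b) + 2 * len g"
    and x: "proj_within \<tau>\<^sub>2 x" and x': "proj_within \<tau>\<^sub>2 x'"
    and eq: "\<phi> (b \<otimes> link N) x = \<phi> (b' \<otimes> link N) x'"
  shows "len (inv (b \<otimes> link N) \<otimes> (b' \<otimes> link N)) \<le> sep N"
proof -
  have c [simp]: "b \<in> carrier G" "b' \<in> carrier G"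
    using b b' by (simp_all add: good_def)
  show ?thesis
  proof (cases "len b \<le> len b'")
    case True
    have "len (inv (b \<otimes> link N) \<otimes> (b' \<otimes> link N)) \<le> len (inv (b \<otimes> link N) \<otimes> b') + len (link N)"
      using len_mult[of "inv (b \<otimes> link N) \<otimes> b'" "link N"] by (simp add: m_assoc)
    then show ?thesis
      using word_separation_aux[OF N b b' True min x x' eq] by (simp add: sep_def)
  next
    case False
    have "len (inv (b' \<otimes> link N) \<otimes> (b \<otimes> link N)) \<le> len (inv (b' \<otimes> link N) \<otimes> b) + len (link N)"
      using len_mult[of "inv (b' \<otimes> link N) \<otimes> b" "link N"] by (simp add: m_assoc)
    moreover have "len (inv (b \<otimes> link N) \<otimes> (b' \<otimes> link N)) = len (inv (b' \<otimes> link N) \<otimes> (b \<otimes> link N))"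
      using len_inv[of "inv (b \<otimes> link N) \<otimes> (b' \<otimes> link N)"] by (simp add: inv_mult_group m_assoc)
    ultimately show ?thesis
      using word_separation_aux[OF N b' b _ min' x' x eq[symmetric]] False by (simp add: sep_def)
  qed
qed

text \<open>Joins geometry and counting: by \<open>proj_within_word_step\<close> all words keep the
  bound \<open>\<tau>\<^sub>2\<close>, which \<open>word_separation\<close> asks of the remainders
  \<open>x\<close> and \<open>x'\<close>.\<close>

lemma growth_exponent_ge_near_minimal:
  assumes N: "long N" and fin: "finite E\<^sub>0"
    and good: "\<And>b. b \<in> E\<^sub>0 \<Longrightarrow> good b" and large: "\<And>b. b \<in> E\<^sub>0 \<Longrightarrow> 2 * \<tau>\<^sub>0 + D < len b"
    and min: "\<And>b b'. \<lbrakk>b \<in> E\<^sub>0; b' \<in> E\<^sub>0\<rbrakk>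
      \<Longrightarrow> len b' \<le> len (b \<otimes> inv (link N) \<otimes> inv b \<otimes> b') + 2 * len g"
    and s: "0 \<le> s"
    and sum: "real (card {x \<in> carrier G. len x \<le> sep N})
      < (\<Sum>b\<in>E\<^sub>0. exp (- s * (len b + len (link N))))"
  shows "ereal s \<le> growth_exponent G \<phi> p"
proof -
  define E where "E = (\<lambda>b. b \<otimes> link N) ` E\<^sub>0"
  have closed: "b \<in> carrier G" if "b \<in> E\<^sub>0" for b
    using good[OF that] by (simp add: good_def)
  then have E: "finite E" "E \<subseteq> carrier G"
    using fin by (auto simp: E_def)
  have near: "proj_within \<tau>\<^sub>2 (\<phi> V p)" if "V \<in> words E n" for V n
    using that
  proof (induction n arbitrary: V)
    case 0
    then show ?case
      using \<tau>_nonneg by (simp add: proj_within_base)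
  next
    case (Suc n)
    then obtain b V' where b: "b \<in> E\<^sub>0" and V': "V' \<in> words E n" "V = b \<otimes> link N \<otimes> V'"
      by (auto simp: E_def)
    have "V' \<in> carrier G"
      using E V' words_closed by blast
    then have "\<phi> V p = \<phi> (b \<otimes> link N) (\<phi> V' p)"
      using closed[OF b] by (simp add: V' act_mult)
    then show ?case
      using proj_within_word_step[OF N good[OF b] large[OF b] Suc.IH[OF V'(1)]] by simp
  qed
  show ?thesis
  proof (rule growth_exponent_ge_words[OF E s])
    fix n e e' V V'
    assume *: "e \<in> E" "e' \<in> E" "V \<in> words E n" "V' \<in> words E n" "e \<otimes> V = e' \<otimes> V'"
    obtain b b' where b: "b \<in> E\<^sub>0" "e = b \<otimes> link N" "b' \<in> E\<^sub>0" "e' = b' \<otimes> link N"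
      using *(1,2) unfolding E_def by blast
    have "e \<in> carrier G" "e' \<in> carrier G" "V \<in> carrier G" "V' \<in> carrier G"
      using * E words_closed by blast+
    then have "\<phi> e (\<phi> V p) = \<phi> e' (\<phi> V' p)"
      using *(5) by (metis act_mult)
    then show "len (inv e \<otimes> e') \<le> sep N"
      using word_separation[OF N good good min min near[OF *(3)] near[OF *(4)]] b by simp
  next
    note sum
    also have "(\<Sum>b\<in>E\<^sub>0. exp (- s * (len b + len (link N)))) \<le> (\<Sum>b\<in>E\<^sub>0. exp (- s * len (b \<otimes> link N)))"
    proof (intro sum_mono)
      fix b assume "b \<in> E\<^sub>0"
      then show "exp (- s * (len b + len (link N))) \<le> exp (- s * len (b \<otimes> link N))"
        using s len_mult[of b "link N"] closed by (simp add: mult_left_mono)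
    qed
    also have "\<dots> = (\<Sum>e\<in>E. exp (- s * len e))"
      unfolding E_def using closed by (subst sum.reindex) (auto simp: inj_on_def)
    finally show "real (card {x \<in> carrier G. len x \<le> sep N}) < (\<Sum>e\<in>E. exp (- s * len e))" .
  qed
qed

end

section \<open>Growth of the quotient\<close>

text \<open>The Poincare series of a set with at least exponential growth diverges at the exponent:
  if it converged, then its tails would show that the growth is \<open>o(e\<^sup>\<delta>\<^sup>n)\<close>.\<close>

lemma exp_sum_diverges:
  fixes a :: "'u \<Rightarrow> real"
  assumes inf: "infinite Y" and fin: "\<And>r. finite {x \<in> Y. a x \<le> r}" and \<delta>: "0 \<le> \<delta>"
    and growth: "\<And>n. (1::nat) \<le> n \<Longrightarrow> exp (\<delta> * n) \<le> card {x \<in> Y. a x \<le> n + c}"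
  shows "\<exists>F. finite F \<and> F \<subseteq> Y \<and> K < (\<Sum>x\<in>F. exp (- \<delta> * a x))"
proof (cases "\<delta> = 0")
  case True
  obtain n where n: "K < real n"
    using reals_Archimedean2 by blast
  obtain F where "finite F" "card F = n" "F \<subseteq> Y"
    using infinite_arbitrarily_large[OF inf] by blast
  then show ?thesis
    using n True by (intro exI[of _ F]) simp
next
  case False
  show ?thesis
  proof (rule ccontr)
    assume "\<not> ?thesis"
    then have bound: "(\<Sum>x\<in>F. exp (- \<delta> * a x)) \<le> K" if "finite F" "F \<subseteq> Y" for F
      using that not_le by blast
    define \<S> where "\<S> = (\<lambda>F. \<Sum>x\<in>F. exp (- \<delta> * a x)) ` {F. finite F \<and> F \<subseteq> Y}"
    have ne: "\<S> \<noteq> {}"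
      unfolding \<S>_def by blast
    have bdd: "bdd_above \<S>"
      unfolding \<S>_def using bound by (intro bdd_aboveI2[where M = K]) simp
    \<comment> \<open>Chosen so that a tail sum of at most \<open>\<epsilon>\<close> leaves at most
      \<open>exp (\<delta> * n) / 2\<close> elements in \<open>T\<close>; the other half of the
      growth would have to come from the fixed \<open>m\<close> elements.\<close>
    define \<epsilon> where "\<epsilon> = exp (- \<delta> * c) / 2"
    have "0 < \<epsilon>"
      by (simp add: \<epsilon>_def)
    then obtain F0 where F0: "finite F0" "F0 \<subseteq> Y" "Sup \<S> - \<epsilon> < (\<Sum>x\<in>F0. exp (- \<delta> * a x))"
      using less_cSupD[OF ne, of "Sup \<S> - \<epsilon>"] by (auto simp: \<S>_def)
    obtain r where r: "\<And>x. x \<in> F0 \<Longrightarrow> a x \<le> r"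
      using bdd_above_finite[of "a ` F0"] F0(1) by (auto simp: bdd_above_def)
    define m where "m = card {x \<in> Y. a x \<le> r}"
    have "exp (\<delta> * n) \<le> 2 * m" if "1 \<le> n" for n :: nat
    proof -
      define T where "T = {x \<in> Y. a x \<le> n + c \<and> r < a x}"
      have T: "T \<subseteq> Y" "T \<inter> F0 = {}"
        using r by (force simp: T_def)+
      have "T \<subseteq> {x \<in> Y. a x \<le> n + c}"
        by (auto simp: T_def)
      then have finT: "finite T"
        using fin finite_subset by blast
      have "(\<Sum>x\<in>T. exp (- \<delta> * a x)) + (\<Sum>x\<in>F0. exp (- \<delta> * a x)) = (\<Sum>x\<in>T \<union> F0. exp (- \<delta> * a x))"
        using sum.union_disjoint[OF finT F0(1) T(2)] by metis
      also have "\<dots> \<le> Sup \<S>"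
        using finT F0 T bdd unfolding \<S>_def by (intro cSup_upper imageI) auto
      finally have tail: "(\<Sum>x\<in>T. exp (- \<delta> * a x)) \<le> \<epsilon>"
        using F0(3) by linarith
      have "card T * exp (- \<delta> * (n + c)) = (\<Sum>x\<in>T. exp (- \<delta> * (n + c)))"
        by simp
      also have "\<dots> \<le> (\<Sum>x\<in>T. exp (- \<delta> * a x))"
        using \<delta> by (intro sum_mono) (simp add: T_def mult_left_mono)
      also note tail
      finally have "card T * exp (- \<delta> * (n + c)) * exp (\<delta> * (n + c)) \<le> \<epsilon> * exp (\<delta> * (n + c))"
        by (intro mult_right_mono) simp_all
      then have cardT: "card T \<le> exp (\<delta> * n) / 2"
        by (simp add: \<epsilon>_def mult.assoc distrib_left flip: exp_add)
      have "{x \<in> Y. a x \<le> n + c} \<subseteq> {x \<in> Y. a x \<le> r} \<union> T"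
        by (auto simp: T_def)
      then have "card {x \<in> Y. a x \<le> n + c} \<le> card ({x \<in> Y. a x \<le> r} \<union> T)"
        using fin finT by (intro card_mono) simp_all
      also have "\<dots> \<le> m + card T"
        unfolding m_def by (rule card_Un_le)
      finally have "exp (\<delta> * n) \<le> real m + real (card T)"
        using growth[OF that] by linarith
      then show ?thesis
        using cardT by linarith
    qed
    then have le: "exp \<delta> ^ n \<le> 2 * m" if "1 \<le> n" for n :: nat
      using that by (simp add: mult.commute flip: exp_of_nat_mult)
    obtain n where n: "2 * real m < exp \<delta> ^ n"
      using real_arch_pow[of "exp \<delta>"] False \<delta> by auto
    also have "\<dots> \<le> exp \<delta> ^ Suc n"
      using \<delta> by (intro power_increasing) simp_all
    finally show False
      using le[of "Suc n"] by simp
  qed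
qed

text \<open>Fekete's argument: rounding \<open>r / n\<close> up to an integer costs one extra
  \<open>L\<close>, which vanishes after division by \<open>r\<close>.\<close>

lemma growth_rate_le_of_pow_bound:
  assumes n: "1 \<le> n" and L: "0 \<le> L" and pos: "\<And>r. 0 \<le> r \<Longrightarrow> 1 \<le> N r"
    and bound: "\<And>r k. \<lbrakk>1 \<le> r; r \<le> real k * n\<rbrakk> \<Longrightarrow> ln (real (N r)) \<le> real k * L"
  shows "exponential_growth_rate N \<le> ereal (L / n)"
proof -
  have "1 / r * ln (real (N r)) \<le> L / n + L * inverse r" if r: "1 \<le> r" for r
  proof -
    define k where "k = nat \<lceil>r / n\<rceil>"
    have k: "r / n \<le> real k" "real k \<le> r / n + 1"
      using r n unfolding k_def by (auto simp: of_nat_nat)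
    then have "r \<le> real k * n"
      using n by (simp add: field_simps)
    then have "ln (real (N r)) \<le> real k * L"
      by (rule bound[OF r])
    also have "\<dots> \<le> (r / n + 1) * L"
      using k L by (intro mult_right_mono)
    finally have "1 / r * ln (real (N r)) \<le> 1 / r * ((r / n + 1) * L)"
      using r by (intro mult_left_mono) simp_all
    also have "\<dots> = L / n + L * inverse r"
      using r n by (simp add: field_simps)
    finally show ?thesis .
  qed
  then have "eventually (\<lambda>r. ereal (1 / r * ln (real (N r))) \<le> ereal (L / n + L * inverse r)) at_top"
    by (auto intro!: eventually_at_top_linorderI[of 1])
  then have "exponential_growth_rate N \<le> Limsup at_top (\<lambda>r. ereal (L / n + L * inverse r))"
    unfolding exponential_growth_rate_def by (rule Limsup_mono)
  also have "\<dots> = ereal (L / n)"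
  proof (rule lim_imp_Limsup)
    have "((\<lambda>r. L / n + L * inverse r) \<longlongrightarrow> L / n + L * 0) at_top"
      by (intro tendsto_intros tendsto_inverse_0_at_top filterlim_ident)
    then show "((\<lambda>r. ereal (L / n + L * inverse r)) \<longlongrightarrow> ereal (L / n)) at_top"
      by simp
  qed simp
  finally show ?thesis .
qed

locale isometry_group_quotient = isometry_group + normal \<Gamma> G for \<Gamma>
begin

definition nrm :: "'a set \<Rightarrow> real" where
  "nrm U = coset_dist \<phi> p \<Gamma> U"

abbreviation cosets :: "'a set set" where
  "cosets \<equiv> carrier (G Mod \<Gamma>)"

lemma cosetsE:
  assumes "U \<in> cosets"
  obtains b where "b \<in> carrier G" "U = \<Gamma> #> b"
  using assms by (auto simp: FactGroup_def RCOSETS_def)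

lemma coset_in_cosets: "b \<in> carrier G \<Longrightarrow> \<Gamma> #> b \<in> cosets"
  by (auto simp: FactGroup_def RCOSETS_def)

lemma mem_coset: "b \<in> carrier G \<Longrightarrow> b \<in> \<Gamma> #> b"
  using rcos_self subgroup_axioms by blast

lemma coset_eqI: "\<lbrakk>U \<in> cosets; b \<in> U\<rbrakk> \<Longrightarrow> U = \<Gamma> #> b"
  by (metis cosetsE repr_independence subgroup_axioms)

lemma coset_subset: "U \<in> cosets \<Longrightarrow> U \<subseteq> carrier G"
  by (metis cosetsE r_coset_subset_G subset)

lemma coset_mult_left: "\<lbrakk>U \<in> cosets; b \<in> U; \<gamma> \<in> \<Gamma>\<rbrakk> \<Longrightarrow> \<gamma> \<otimes> b \<in> U"
  using coset_eqI[of U b] by (auto simp: r_coset_def)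

lemma coset_mult_right: "\<lbrakk>U \<in> cosets; b \<in> U; \<gamma> \<in> \<Gamma>\<rbrakk> \<Longrightarrow> b \<otimes> \<gamma> \<in> U"
proof -
  assume *: "U \<in> cosets" "b \<in> U" "\<gamma> \<in> \<Gamma>"
  then have b: "b \<in> carrier G"
    using coset_subset by blast
  then have "b \<otimes> \<gamma> \<otimes> inv b \<in> \<Gamma>"
    using * inv_op_closed2 by simp
  then have "b \<otimes> \<gamma> \<otimes> inv b \<otimes> b \<in> U"
    using * coset_mult_left by blast
  then show ?thesis
    using b * by (simp add: m_assoc)
qed

lemma nrm_attained:
  assumes U: "U \<in> cosets"
  shows "\<exists>b\<in>U. nrm U = len b \<and> (\<forall>x\<in>U. len b \<le> len x)"
proof -
  obtain b0 where b0: "b0 \<in> U"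
    using cosetsE[OF U] mem_coset by metis
  define S where "S = {x \<in> U. len x \<le> len b0}"
  have "S \<subseteq> {x \<in> carrier G. len x \<le> len b0}"
    using coset_subset[OF U] by (auto simp: S_def)
  then have "finite S"
    using finite_len_le finite_subset by blast
  moreover have "b0 \<in> S"
    using b0 by (simp add: S_def)
  ultimately obtain b where b: "b \<in> S" "\<And>x. x \<in> S \<Longrightarrow> len b \<le> len x"
    using arg_min_if_finite[of S len] by (metis empty_iff not_less)
  have bU: "b \<in> U"
    using b by (simp add: S_def)
  have min: "len b \<le> len x" if "x \<in> U" for x
    using b that unfolding S_def by (smt (verit) mem_Collect_eq)
  have dist_eq: "dist (\<phi> u p) (\<phi> v p) = len (inv u \<otimes> v)" if "u \<in> \<Gamma>" "v \<in> U" for u v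
    using that coset_subset[OF U] by (intro dist_orbit) auto
  have "nrm U = len b"
    unfolding nrm_def coset_dist_def
  proof (rule cInf_eq_minimum)
    show "len b \<in> (\<lambda>(u, v). dist (\<phi> u p) (\<phi> v p)) ` (\<Gamma> \<times> U)"
      using bU one_closed by (intro image_eqI[of _ _ "(\<one>, b)"]) (simp_all add: len_def)
    fix d assume "d \<in> (\<lambda>(u, v). dist (\<phi> u p) (\<phi> v p)) ` (\<Gamma> \<times> U)"
    then obtain u v where uv: "u \<in> \<Gamma>" "v \<in> U" "d = len (inv u \<otimes> v)"
      using dist_eq by auto
    then show "len b \<le> d"
      using min coset_mult_left[OF U uv(2), of "inv u"] by simp
  qed
  then show ?thesis
    using bU min by blast
qed

lemma nrm_le: "\<lbrakk>U \<in> cosets; x \<in> U\<rbrakk> \<Longrightarrow> nrm U \<le> len x"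
  using nrm_attained by metis

lemma nrm_nonneg: "U \<in> cosets \<Longrightarrow> 0 \<le> nrm U"
  using nrm_attained len_nonneg by metis

lemma finite_nrm_le: "finite {U \<in> cosets. nrm U \<le> r}"
proof -
  have "{U \<in> cosets. nrm U \<le> r} \<subseteq> (\<lambda>b. \<Gamma> #> b) ` {b \<in> carrier G. len b \<le> r}"
  proof clarify
    fix U assume U: "U \<in> cosets" "nrm U \<le> r"
    obtain b where b: "b \<in> U" "nrm U = len b"
      using nrm_attained[OF U(1)] by blast
    then show "U \<in> (\<lambda>b. \<Gamma> #> b) ` {b \<in> carrier G. len b \<le> r}"
      using U coset_eqI coset_subset by (intro image_eqI[of _ _ b]) auto
  qed
  then show ?thesis
    using finite_len_le finite_surj by blast
qed

definition Q :: "real \<Rightarrow> nat" where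
  "Q r = card {U \<in> cosets. nrm U \<le> r}"

lemma Q_mono: "r \<le> r' \<Longrightarrow> Q r \<le> Q r'"
  unfolding Q_def by (rule card_mono[OF finite_nrm_le]) auto

lemma Q_pos: "0 \<le> r \<Longrightarrow> 1 \<le> Q r"
proof -
  assume r: "0 \<le> r"
  have "\<Gamma> = \<Gamma> #> \<one>"
    using subset by simp
  then have \<Gamma>: "\<Gamma> \<in> cosets"
    using coset_in_cosets[of \<one>] by simp
  then have "nrm \<Gamma> \<le> r"
    using nrm_le[OF \<Gamma> one_closed] r by simp
  then show ?thesis
    unfolding Q_def using \<Gamma> finite_nrm_le by (simp add: Suc_le_eq card_gt_0_iff) blast
qed

lemma quotient_growth_exponent_eq: "quotient_growth_exponent G \<phi> p \<Gamma> = exponential_growth_rate Q"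
  by (simp add: quotient_growth_exponent_def Q_def[abs_def] nrm_def)

lemma quotient_growth_nonneg: "0 \<le> exponential_growth_rate Q"
  unfolding exponential_growth_rate_def
proof (rule le_Limsup)
  show "\<forall>\<^sub>F r in at_top. 0 \<le> ereal (1 / r * ln (real (Q r)))"
    using Q_pos by (intro eventually_at_top_linorderI[of 1]) simp
qed simp

lemma quotient_growth_finite:
  assumes "finite cosets"
  shows "exponential_growth_rate Q \<le> 0"
proof -
  have card: "Q r \<le> card cosets" for r
    unfolding Q_def using assms by (intro card_mono) auto
  have "exponential_growth_rate Q \<le> Limsup at_top (\<lambda>r. ereal (ln (card cosets) * inverse r))"
    unfolding exponential_growth_rate_def
  proof (rule Limsup_mono, rule eventually_at_top_linorderI[of 1])
    fix r :: real assume r: "1 \<le> r"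
    have "ln (real (Q r)) \<le> ln (real (card cosets))"
      using Q_pos[of r] card[of r] r by (subst ln_le_cancel_iff) simp_all
    then show "ereal (1 / r * ln (real (Q r))) \<le> ereal (ln (card cosets) * inverse r)"
      using r by (simp add: field_simps)
  qed
  also have "\<dots> = ereal 0"
  proof (rule lim_imp_Limsup)
    have "((\<lambda>r. ln (card cosets) * inverse r) \<longlongrightarrow> ln (card cosets) * 0) at_top"
      by (intro tendsto_intros tendsto_inverse_0_at_top filterlim_ident)
    then show "((\<lambda>r. ereal (ln (card cosets) * inverse r)) \<longlongrightarrow> ereal 0) at_top"
      by simp
  qed simp
  finally show ?thesis
    by (simp add: zero_ereal_def)
qed

end

text \<open>Cut a geodesic of the quasi-convex orbit at time \<open>min r L\<close> and take an
  orbit point near the cut. That orbit may belong to another point \<open>x\<^sub>0\<close>, at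
  distance \<open>e\<close> from \<open>p\<close>; each conversion of lengths costs
  \<open>2 * e\<close>.\<close>

lemma (in isometry_group) split_of_quasi_convex:
  assumes qc: "quasi_convex_set C (orbit G \<phi> x\<^sub>0)"
  shows "\<exists>c\<ge>0. \<forall>b\<in>carrier G. \<forall>r\<ge>0. \<forall>t\<ge>0. len b \<le> r + t \<longrightarrow>
    (\<exists>g\<in>carrier G. len g \<le> r + c \<and> len (inv g \<otimes> b) \<le> t + c)"
proof -
  define e where "e = dist p x\<^sub>0"
  define c where "c = max 0 (4 * e + C + 1)"
  have near: "dist (\<phi> g p) (\<phi> g x\<^sub>0) = e" if "g \<in> carrier G" for g
    using that by (simp add: e_def)
  have "\<exists>g\<in>carrier G. len g \<le> r + c \<and> len (inv g \<otimes> b) \<le> t + c"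
    if b: "b \<in> carrier G" and rt: "0 \<le> r" "0 \<le> t" "len b \<le> r + t" for b r t
  proof -
    define L where "L = dist x\<^sub>0 (\<phi> b x\<^sub>0)"
    have L: "0 \<le> L" "L \<le> r + t + 2 * e"
      using rt near[OF b] dist_triangle[of x\<^sub>0 "\<phi> b x\<^sub>0" p] dist_triangle[of p "\<phi> b x\<^sub>0" "\<phi> b p"]
      by (simp_all add: L_def len_def e_def dist_commute)
    have "x\<^sub>0 \<in> orbit G \<phi> x\<^sub>0" "\<phi> b x\<^sub>0 \<in> orbit G \<phi> x\<^sub>0"
      using b act_one[of x\<^sub>0, symmetric] by (auto simp: orbit_def simp del: act_one)
    then obtain \<alpha> where "is_geodesic \<alpha> x\<^sub>0 (\<phi> b x\<^sub>0)"
      and \<alpha>_near: "\<alpha> ` {0..L} \<subseteq> closed_nbhd C (orbit G \<phi> x\<^sub>0)"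
      using qc unfolding quasi_convex_set_def L_def by blast
    then have \<alpha>: "\<alpha> 0 = x\<^sub>0" "\<alpha> L = \<phi> b x\<^sub>0"
      and iso: "\<And>s t. \<lbrakk>s \<in> {0..L}; t \<in> {0..L}\<rbrakk> \<Longrightarrow> dist (\<alpha> s) (\<alpha> t) = \<bar>s - t\<bar>"
      by (auto simp: is_geodesic_def L_def)
    define u where "u = min r L"
    have u: "u \<in> {0..L}" "u \<le> r" "L - u \<le> t + 2 * e"
      using L rt near[OF b] zero_le_dist[of p x\<^sub>0] by (auto simp: u_def e_def min_def)
    then have "\<alpha> u \<in> closed_nbhd C (orbit G \<phi> x\<^sub>0)"
      using \<alpha>_near by blast
    then have "infdist (\<alpha> u) (orbit G \<phi> x\<^sub>0) < C + 1"
      by (simp add: closed_nbhd_def)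
    moreover have "orbit G \<phi> x\<^sub>0 \<noteq> {}"
      using \<open>x\<^sub>0 \<in> orbit G \<phi> x\<^sub>0\<close> by blast
    ultimately obtain y where "y \<in> orbit G \<phi> x\<^sub>0" "dist (\<alpha> u) y < C + 1"
      using cInf_lessD[of "dist (\<alpha> u) ` orbit G \<phi> x\<^sub>0" "C + 1"] by (auto simp: infdist_notempty)
    then obtain g where g: "g \<in> carrier G" "dist (\<alpha> u) (\<phi> g x\<^sub>0) < C + 1"
      by (auto simp: orbit_def)
    have "dist x\<^sub>0 (\<alpha> u) = u" "dist (\<alpha> u) (\<phi> b x\<^sub>0) = L - u"
      using iso[of 0 u] iso[of u L] u L \<alpha> by auto
    have "len g \<le> 2 * e + dist x\<^sub>0 (\<phi> g x\<^sub>0)"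
      using dist_triangle[of p "\<phi> g p" x\<^sub>0] dist_triangle[of x\<^sub>0 "\<phi> g p" "\<phi> g x\<^sub>0"] near[OF g(1)]
      by (simp add: len_def e_def dist_commute)
    also have "dist x\<^sub>0 (\<phi> g x\<^sub>0) \<le> u + (C + 1)"
      using dist_triangle[of x\<^sub>0 "\<phi> g x\<^sub>0" "\<alpha> u"] \<open>dist x\<^sub>0 (\<alpha> u) = u\<close> g by simp
    finally have "len g \<le> r + c"
      using u zero_le_dist[of p x\<^sub>0] by (simp add: c_def flip: e_def)
    have "len (inv g \<otimes> b) = dist (\<phi> g p) (\<phi> b p)"
      using g b by (simp add: dist_orbit)
    also have "\<dots> \<le> 2 * e + dist (\<phi> g x\<^sub>0) (\<phi> b x\<^sub>0)"
      using dist_triangle[of "\<phi> g p" "\<phi> b p" "\<phi> g x\<^sub>0"] near[OF g(1)] near[OF b]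
        dist_triangle[of "\<phi> g x\<^sub>0" "\<phi> b p" "\<phi> b x\<^sub>0"]
      by (simp add: dist_commute)
    also have "dist (\<phi> g x\<^sub>0) (\<phi> b x\<^sub>0) \<le> (C + 1) + (L - u)"
      using dist_triangle3[of "\<phi> g x\<^sub>0" "\<phi> b x\<^sub>0" "\<alpha> u"] \<open>dist (\<alpha> u) (\<phi> b x\<^sub>0) = L - u\<close> g by simp
    finally have "len (inv g \<otimes> b) \<le> t + c"
      using u by (simp add: c_def)
    then show ?thesis
      using g \<open>len g \<le> r + c\<close> by blast
  qed
  moreover have "0 \<le> c"
    by (simp add: c_def)
  ultimately show ?thesis
    by blast
qed

section \<open>Submultiplicative growth of the quotient and its Poincare series\<close>

context isometry_group_quotient
begin

context
  fixes c :: real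
  assumes c: "0 \<le> c"
    and split: "\<And>b r t. \<lbrakk>b \<in> carrier G; 0 \<le> r; 0 \<le> t; len b \<le> r + t\<rbrakk>
      \<Longrightarrow> \<exists>g\<in>carrier G. len g \<le> r + c \<and> len (inv g \<otimes> b) \<le> t + c"
begin

lemma Q_submultiplicative:
  assumes rt: "0 \<le> r" "0 \<le> t"
  shows "Q (r + t) \<le> Q (r + c) * Q (t + c)"
proof -
  let ?B = "\<lambda>r. {U \<in> cosets. nrm U \<le> r}"
  have "?B (r + t) \<subseteq> (\<lambda>(V, W). V <#> W) ` (?B (r + c) \<times> ?B (t + c))"
  proof clarify
    fix U assume U: "U \<in> cosets" "nrm U \<le> r + t"
    obtain b where b: "b \<in> U" "nrm U = len b"
      using nrm_attained[OF U(1)] by blast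
    have bc: "b \<in> carrier G"
      using b U coset_subset by blast
    obtain g where g: "g \<in> carrier G" "len g \<le> r + c" "len (inv g \<otimes> b) \<le> t + c"
      using split[OF bc rt] U b by auto
    have nrm_coset: "nrm (\<Gamma> #> x) \<le> len x" if "x \<in> carrier G" for x
      using nrm_le[OF coset_in_cosets[OF that] mem_coset[OF that]] .
    then have "\<Gamma> #> g \<in> ?B (r + c)" "\<Gamma> #> (inv g \<otimes> b) \<in> ?B (t + c)"
      using g bc coset_in_cosets by (auto intro: order_trans[OF nrm_coset])
    moreover have "(\<Gamma> #> g) <#> (\<Gamma> #> (inv g \<otimes> b)) = U"
      using rcos_sum[of g "inv g \<otimes> b"] g bc coset_eqI[OF U(1) b(1)] by (simp add: m_assoc[symmetric])
    ultimately show "U \<in> (\<lambda>(V, W). V <#> W) ` (?B (r + c) \<times> ?B (t + c))"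
      by (intro image_eqI[of _ _ "(\<Gamma> #> g, \<Gamma> #> (inv g \<otimes> b))"]) auto
  qed
  then have "Q (r + t) \<le> card (?B (r + c) \<times> ?B (t + c))"
    unfolding Q_def by (intro surj_card_le finite_cartesian_product finite_nrm_le)
  then show ?thesis
    by (simp add: card_cartesian_product Q_def)
qed

text \<open>The shift \<open>2 * c\<close> absorbs the splitting error: written as
  \<open>(k * r + c) + (r + c)\<close>, the radius splits into two radii with the same
  shift.\<close>

lemma Q_multiple:
  assumes "0 \<le> r" "1 \<le> k"
  shows "Q (real k * r + 2 * c) \<le> Q (r + 2 * c) ^ k"
  using assms(2)
proof (induction k rule: dec_induct)
  case (step k)
  have "Q (real (Suc k) * r + 2 * c) = Q ((real k * r + c) + (r + c))"
    by (simp add: algebra_simps)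
  also have "\<dots> \<le> Q (real k * r + 2 * c) * Q (r + 2 * c)"
    using Q_submultiplicative[of "real k * r + c" "r + c"] assms c by (simp add: add.assoc)
  also have "\<dots> \<le> Q (r + 2 * c) ^ k * Q (r + 2 * c)"
    by (intro mult_right_mono step.IH) simp
  finally show ?case
    by (simp add: mult.commute)
qed simp

text \<open>Holding for every \<open>n\<close>, this turns the exponent \<open>\<delta>\<close> into
  the bound \<open>exp (\<delta> * n) \<le> Q (n + 2 * c)\<close> without subexponential loss;
  \<open>n = 1\<close> shows that the exponent is finite.\<close>

lemma quotient_growth_le:
  assumes n: "1 \<le> (n::nat)"
  shows "exponential_growth_rate Q \<le> ereal (ln (Q (n + 2 * c)) / n)"
proof (rule growth_rate_le_of_pow_bound)
  show "0 \<le> ln (real (Q (n + 2 * c)))"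
    using Q_pos[of "n + 2 * c"] c by simp
  fix r :: real and k :: nat
  assume r: "1 \<le> r" "r \<le> real k * real n"
  then have "k \<noteq> 0"
    by (intro notI) simp
  have "Q r \<le> Q (real k * n + 2 * c)"
    using r c by (intro Q_mono) simp
  also have "\<dots> \<le> Q (n + 2 * c) ^ k"
    using \<open>k \<noteq> 0\<close> by (intro Q_multiple) simp_all
  finally have "real (Q r) \<le> real (Q (n + 2 * c)) ^ k"
    by (simp flip: of_nat_power)
  then have "ln (real (Q r)) \<le> ln (real (Q (n + 2 * c)) ^ k)"
    using Q_pos[of r] Q_pos[of "n + 2 * c"] c r by (subst ln_le_cancel_iff) simp_all
  then show "ln (real (Q r)) \<le> real k * ln (real (Q (n + 2 * c)))"
    using Q_pos[of "n + 2 * c"] c by (simp add: ln_realpow)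
qed (use n Q_pos in auto)

lemma quotient_poincare_diverges:
  assumes "infinite cosets"
  obtains \<delta> where "0 \<le> \<delta>" "exponential_growth_rate Q = ereal \<delta>"
    "\<And>K. \<exists>F. finite F \<and> F \<subseteq> cosets \<and> K < (\<Sum>U\<in>F. exp (- \<delta> * nrm U))"
proof -
  have "exponential_growth_rate Q \<noteq> \<infinity>" "exponential_growth_rate Q \<noteq> - \<infinity>"
    using quotient_growth_le[of 1] quotient_growth_nonneg by auto
  then obtain \<delta> where \<delta>: "exponential_growth_rate Q = ereal \<delta>"
    by (cases "exponential_growth_rate Q") auto
  have "0 \<le> \<delta>"
    using quotient_growth_nonneg \<delta> by simp
  moreover have "\<exists>F. finite F \<and> F \<subseteq> cosets \<and> K < (\<Sum>U\<in>F. exp (- \<delta> * nrm U))" for K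
  proof (rule exp_sum_diverges[OF assms finite_nrm_le \<open>0 \<le> \<delta>\<close>])
    fix n :: nat assume n: "1 \<le> n"
    have "\<delta> \<le> ln (Q (n + 2 * c)) / n"
      using quotient_growth_le[OF n] by (simp add: \<delta>)
    then have "\<delta> * n \<le> ln (Q (n + 2 * c))"
      using n by (simp add: field_simps)
    then have "exp (\<delta> * n) \<le> exp (ln (Q (n + 2 * c)))"
      by simp
    also have "\<dots> = Q (n + 2 * c)"
      using Q_pos[of "n + 2 * c"] c by simp
    finally show "exp (\<delta> * n) \<le> card {U \<in> cosets. nrm U \<le> n + 2 * c}"
      by (simp add: Q_def)
  qed
  ultimately show thesis
    using that \<delta> by blast
qed

end

end

section \<open>Growth tightness\<close>

locale transverse_axis_quotient = transverse_axis + isometry_group_quotient +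
  assumes g_mem: "g \<in> \<Gamma>"
begin

lemma link_mem: "link N \<in> \<Gamma>"
  using inv_op_closed2[OF _ g_mem, of "h [^] N"] by (simp add: link_def int_pow_neg)

lemma ex_good_representative:
  assumes U: "U \<in> cosets"
  shows "\<exists>b\<in>U. good b \<and> len b \<le> nrm U + 2 * len g"
proof -
  obtain b where b: "b \<in> U" "nrm U = len b"
    using nrm_attained[OF U] by blast
  have bc: "b \<in> carrier G"
    using b U coset_subset by blast
  obtain u v where uv: "u \<in> {\<one>, g}" "v \<in> {\<one>, inv g}" "good (u \<otimes> b \<otimes> v)"
    using ex_good_translate[OF bc] by blast
  then have uv': "u \<in> \<Gamma>" "v \<in> \<Gamma>" "u \<in> carrier G" "v \<in> carrier G" "len u \<le> len g" "len v \<le> len g"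
    using g_mem by auto
  then have "u \<otimes> b \<otimes> v \<in> U"
    using coset_mult_right[OF U] coset_mult_left[OF U] b by blast
  moreover have "len (u \<otimes> b \<otimes> v) \<le> len u + len b + len v"
    using len_mult[of "u \<otimes> b" v] len_mult[of u b] uv' bc by simp
  ultimately show ?thesis
    using uv uv' b by (intro bexI[of _ "u \<otimes> b \<otimes> v"]) auto
qed

text \<open>\<open>\<kappa>\<close> bounds the excess of a letter over the norm of its coset, so
  passing to letters costs at most the factor \<open>exp ((\<delta> + 1) * \<kappa>)\<close>;
  \<open>Q R\<close> pays for cosets too short for \<open>proj_within_word_step\<close>. Neither
  depends on \<open>F\<close>.\<close>

lemma growth_exponent_gt:
  assumes \<delta>: "0 \<le> \<delta>"
    and div: "\<And>K. \<exists>F. finite F \<and> F \<subseteq> cosets \<and> K < (\<Sum>U\<in>F. exp (- \<delta> * nrm U))"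
  shows "ereal \<delta> < growth_exponent G \<phi> p"
proof -
  obtain N where N: "long N"
    using ex_long by blast
  define M where "M = real (card {x \<in> carrier G. len x \<le> sep N})"
  define \<kappa> where "\<kappa> = 2 * len g + len (link N)"
  define R where "R = 2 * \<tau>\<^sub>0 + D"
  obtain F where F: "finite F" "F \<subseteq> cosets"
    and "M * exp ((\<delta> + 1) * \<kappa>) + Q R < (\<Sum>U\<in>F. exp (- \<delta> * nrm U))"
    using div by blast
  then obtain s where s: "\<delta> < s" "s < \<delta> + 1"
    and sum: "M * exp ((\<delta> + 1) * \<kappa>) + Q R < (\<Sum>U\<in>F. exp (- s * nrm U))"
    using exp_sum_increase_rate by blast
  define F1 where "F1 = {U \<in> F. nrm U \<le> R}"
  define F2 where "F2 = F - F1"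
  have "(\<Sum>U\<in>F1. exp (- s * nrm U)) \<le> (\<Sum>U\<in>F1. 1)"
    using s \<delta> F nrm_nonneg by (intro sum_mono) (auto simp: F1_def)
  also have "\<dots> = real (card F1)"
    by simp
  also have "card F1 \<le> Q R"
    unfolding Q_def using F by (intro card_mono finite_nrm_le) (auto simp: F1_def)
  finally have "M * exp ((\<delta> + 1) * \<kappa>) < (\<Sum>U\<in>F2. exp (- s * nrm U))"
    using sum sum.subset_diff[of F1 F "\<lambda>U. exp (- s * nrm U)"] F by (simp add: F1_def F2_def)
  obtain b where b: "\<And>U. U \<in> cosets \<Longrightarrow> b U \<in> U" "\<And>U. U \<in> cosets \<Longrightarrow> good (b U)"
    "\<And>U. U \<in> cosets \<Longrightarrow> len (b U) \<le> nrm U + 2 * len g"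
    using ex_good_representative by metis
  have F2: "finite F2" "F2 \<subseteq> cosets" "\<And>U. U \<in> F2 \<Longrightarrow> R < nrm U"
    using F by (auto simp: F2_def F1_def)
  have inj: "inj_on b F2"
  proof (rule inj_onI)
    fix U V assume "U \<in> F2" "V \<in> F2" "b U = b V"
    then show "U = V"
      using coset_eqI b(1) F2(2) by (metis subsetD)
  qed
  have "ereal s \<le> growth_exponent G \<phi> p"
  proof (rule growth_exponent_ge_near_minimal[OF N])
    show "finite (b ` F2)"
      using F2 by simp
    show "0 \<le> s"
      using s \<delta> by simp
    show "good x" if "x \<in> b ` F2" for x
      using that b F2 by blast
    show "2 * \<tau>\<^sub>0 + D < len x" if x: "x \<in> b ` F2" for x
    proof -
      obtain U where U: "U \<in> F2" "x = b U"
        using x by blast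
      then have "nrm U \<le> len x"
        using nrm_le b(1) F2(2) by blast
      then show ?thesis
        using F2(3)[OF U(1)] by (simp add: R_def)
    qed
    show "len x' \<le> len (x \<otimes> inv (link N) \<otimes> inv x \<otimes> x') + 2 * len g"
      if xx': "x \<in> b ` F2" "x' \<in> b ` F2" for x x'
    proof -
      obtain U U' where U: "U \<in> cosets" "x = b U" "U' \<in> cosets" "x' = b U'"
        using xx' F2(2) by blast
      have xc: "x \<in> carrier G"
        using U b(2) by (simp add: good_def)
      \<comment> \<open>Cancelling the link multiplies by an element of \<open>\<Gamma>\<close>, so
        the competitor stays in the coset of \<open>x'\<close>.\<close>
      have "x \<otimes> inv (link N) \<otimes> inv x \<in> \<Gamma>"
        using inv_op_closed2[OF xc] link_mem by simp
      then have "x \<otimes> inv (link N) \<otimes> inv x \<otimes> x' \<in> U'"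
        using U b(1) coset_mult_left by simp
      then have "nrm U' \<le> len (x \<otimes> inv (link N) \<otimes> inv x \<otimes> x')"
        using nrm_le U by blast
      then show ?thesis
        using b(3) U by fastforce
    qed
    have "M * exp ((\<delta> + 1) * \<kappa>) * exp (- s * \<kappa>) \<ge> M"
    proof -
      have "0 \<le> (\<delta> + 1 - s) * \<kappa>"
        using s by (simp add: \<kappa>_def)
      then have "1 \<le> exp ((\<delta> + 1) * \<kappa>) * exp (- s * \<kappa>)"
        by (simp add: algebra_simps flip: exp_add)
      then show ?thesis
        by (simp add: M_def mult.assoc mult_le_cancel_left1)
    qed
    also have "M * exp ((\<delta> + 1) * \<kappa>) * exp (- s * \<kappa>) < (\<Sum>U\<in>F2. exp (- s * nrm U)) * exp (- s * \<kappa>)"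
      using \<open>M * exp ((\<delta> + 1) * \<kappa>) < _\<close> by (intro mult_strict_right_mono) simp_all
    also have "\<dots> = (\<Sum>U\<in>F2. exp (- s * (nrm U + \<kappa>)))"
      unfolding sum_distrib_right by (intro sum.cong refl) (simp add: algebra_simps flip: exp_add)
    also have "\<dots> \<le> (\<Sum>U\<in>F2. exp (- s * (len (b U) + len (link N))))"
    proof (rule sum_mono)
      fix U assume "U \<in> F2"
      then have "len (b U) + len (link N) \<le> nrm U + \<kappa>"
        using b(3) F2(2) by (fastforce simp: \<kappa>_def)
      then show "exp (- s * (nrm U + \<kappa>)) \<le> exp (- s * (len (b U) + len (link N)))"
        using s \<delta> by (simp add: mult_left_mono)
    qed
    also have "\<dots> = (\<Sum>x\<in>b ` F2. exp (- s * (len x + len (link N))))"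
      using inj by (simp add: sum.reindex)
    finally show "real (card {x \<in> carrier G. len x \<le> sep N}) < \<dots>"
      by (simp add: M_def)
  qed
  then show ?thesis
    using s order.strict_trans2[of "ereal \<delta>" "ereal s"] by simp
qed

end

section \<open>From the given action to the locales\<close>

lemma isometry_group_of_G_space:
  fixes \<phi> :: "'g \<Rightarrow> 'x::metric_space \<Rightarrow> 'x"
  assumes "group G" "G_space G \<phi>"
  shows "isometry_group G \<phi> p"
proof -
  interpret group G
    by fact
  have iso: "isometric_action G \<phi>" and pd: "properly_discontinuous G \<phi>"
    and proper: "proper_space TYPE('x)"
    using assms(2) by (simp_all add: G_space_def)
  interpret group_action G UNIV \<phi>
    using iso by (simp add: isometric_action_def)
  show ?thesis
  proof
    show "\<phi> (g \<otimes>\<^bsub>G\<^esub> k) x = \<phi> g (\<phi> k x)" if "g \<in> carrier G" "k \<in> carrier G" for g k x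
      using composition_rule that by simp
    show "\<phi> \<one>\<^bsub>G\<^esub> x = x" for x
      using fun_cong[OF id_eq_one, of x] by simp
    show "dist (\<phi> g x) (\<phi> g y) = dist x y" if "g \<in> carrier G" for g x y
      using iso that by (simp add: isometric_action_def)
    show "finite {g \<in> carrier G. dist p (\<phi> g p) \<le> r}" for r
    proof (rule finite_subset)
      show "{g \<in> carrier G. dist p (\<phi> g p) \<le> r} \<subseteq> {g \<in> carrier G. \<phi> g ` cball p r \<inter> cball p r \<noteq> {}}"
        by clarsimp (metis IntI centre_in_cball empty_iff imageI mem_cball order_trans zero_le_dist)
      have "compact (cball p r)"
        using proper by (simp add: proper_space_def)
      then show "finite {g \<in> carrier G. \<phi> g ` cball p r \<inter> cball p r \<noteq> {}}"
        using pd by (simp add: properly_discontinuous_def)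
    qed
  qed
qed

text \<open>The lower quasi-isometry bound gives \<open>finite_pow\<close>. The compact set
  \<open>Y\<close> of the cocompact action lies within \<open>\<rho>\<close> of \<open>p\<close>, so
  \<open>A\<close> and the axis are within \<open>\<rho>\<close> of each other.\<close>

lemma (in isometry_group) contracting_axis_of_strongly_contracting_element:
  assumes geod: "geodesic_space TYPE('c)" and sc: "strongly_contracting_element G \<phi> p h"
  obtains D where "contracting_axis G \<phi> p h D"
proof -
  have h: "h \<in> carrier G" and qi: "quasi_isometric_embedding_int (\<lambda>i. \<phi> (h [^] i) p)"
    using sc by (simp_all add: strongly_contracting_element_def)
  obtain K C where K: "1 \<le> K"
    and qi': "\<And>i j. \<bar>real_of_int i - real_of_int j\<bar> / K - C \<le> dist (\<phi> (h [^] i) p) (\<phi> (h [^] j) p)"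
    using qi by (auto simp: quasi_isometric_embedding_int_def)
  interpret powers_axis G \<phi> p h
  proof
    fix r
    have "{i::int. len (h [^] i) \<le> r} \<subseteq> {- \<lceil>K * (r + C)\<rceil>..\<lceil>K * (r + C)\<rceil>}"
    proof
      fix i :: int assume "i \<in> {i. len (h [^] i) \<le> r}"
      then have "\<bar>real_of_int i\<bar> / K \<le> r + C"
        using qi'[of i 0] by (simp add: len_def dist_commute)
      then have "\<bar>real_of_int i\<bar> \<le> K * (r + C)"
        using K by (simp add: field_simps)
      then show "i \<in> {- \<lceil>K * (r + C)\<rceil>..\<lceil>K * (r + C)\<rceil>}"
        by (simp add: abs_le_iff) linarith
    qed
    then show "finite {i::int. len (h [^] i) \<le> r}"
      by (rule finite_subset) simp
  qed (rule h)
  obtain A \<pi> where A: "acts_cocompactly_on (generate G {h}) \<phi> A" and \<pi>: "strongly_contracting_map \<pi> A"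
    using sc by (auto simp: strongly_contracting_element_def)
  obtain C where C: "contracting_projection \<pi> A C"
    using strongly_contracting_map_projection[OF geod \<pi>] by blast
  have gen: "generate G {h} = range (\<lambda>k::int. h [^] k)"
    using generate_pow[OF h] by auto
  obtain Y where Y: "compact Y" "Y \<subseteq> A" and cover: "A \<subseteq> (\<Union>g\<in>generate G {h}. \<phi> g ` Y)"
    and inv: "\<And>g. g \<in> generate G {h} \<Longrightarrow> \<phi> g ` A \<subseteq> A"
    using A by (auto simp: acts_cocompactly_on_def)
  obtain \<rho> where \<rho>: "\<And>y. y \<in> Y \<Longrightarrow> dist p y \<le> \<rho>"
    using compact_imp_bounded[OF Y(1)] bounded_any_center[of Y p] by auto
  have "A \<noteq> {}"
    using contracting_projection.proj_nonempty[OF C] contracting_projection.proj_subset[OF C] by blast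
  then obtain y where y: "y \<in> Y"
    using cover by blast
  show thesis
  proof (rule contracting_axis_of_projection[OF C _ _ that])
    show "\<exists>j. dist a (axis_pt j) \<le> \<rho>" if a: "a \<in> A" for a
    proof -
      obtain j :: int and x where "x \<in> Y" "a = \<phi> (h [^] j) x"
        using a cover unfolding gen by blast
      then show ?thesis
        using \<rho>[of x] by (intro exI[of _ j]) (simp add: axis_pt_def dist_commute)
    qed
    show "\<exists>a\<in>A. dist (axis_pt i) a \<le> \<rho>" for i
    proof
      show "\<phi> (h [^] i) y \<in> A"
        using inv[of "h [^] i"] y Y(2) gen by blast
      show "dist (axis_pt i) (\<phi> (h [^] i) y) \<le> \<rho>"
        using \<rho>[OF y] by (simp add: axis_pt_def)
    qed
  qed
qed

theorem theorem6p4: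
  fixes G :: "('g, 'm) monoid_scheme"
    and \<phi> :: "'g \<Rightarrow> 'x::metric_space \<Rightarrow> 'x"
    and p :: 'x
  assumes "group G"
    and "finitely_generated_group G"
    and "\<not> elementary_group G"
    and "quasi_convex_G_space G \<phi>"
    and "\<exists>h\<in>carrier G. strongly_contracting_element G \<phi> p h"
  shows "growth_tight G \<phi> p"
  unfolding growth_tight_def
proof (intro allI impI, elim conjE)
  fix \<Gamma> assume \<Gamma>: "\<Gamma> \<lhd> G" "infinite \<Gamma>"
  have space: "G_space G \<phi>"
    using assms(4) by (simp add: quasi_convex_G_space_def)
  then have geod: "geodesic_space TYPE('x)"
    by (simp add: G_space_def)
  obtain x\<^sub>0 C where qc: "quasi_convex_set C (orbit G \<phi> x\<^sub>0)"
    using assms(4) by (auto simp: quasi_convex_G_space_def)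
  obtain h where h: "strongly_contracting_element G \<phi> p h"
    using assms(5) by blast
  interpret isometry_group G \<phi> p
    by (rule isometry_group_of_G_space[OF assms(1) space])
  obtain D where "contracting_axis G \<phi> p h D"
    using contracting_axis_of_strongly_contracting_element[OF geod h] by blast
  then interpret contracting_axis G \<phi> p h D .
  obtain g B where g: "g \<in> \<Gamma>" "\<And>i. proj_within B (\<phi> g (axis_pt i))"
    "\<And>i. proj_within B (\<phi> (inv\<^bsub>G\<^esub> g) (axis_pt i))"
    using ex_transverse_in_normal[OF geod assms(3) \<Gamma>] by blast
  interpret normal \<Gamma> G
    by (rule \<Gamma>)
  interpret transverse_axis_quotient G \<phi> p h D g B \<Gamma>
    by unfold_locales (use g in auto)
  obtain c where c: "0 \<le> c" "\<And>b r t. \<lbrakk>b \<in> carrier G; 0 \<le> r; 0 \<le> t; len b \<le> r + t\<rbrakk>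
      \<Longrightarrow> \<exists>g\<in>carrier G. len g \<le> r + c \<and> len (inv\<^bsub>G\<^esub> g \<otimes>\<^bsub>G\<^esub> b) \<le> t + c"
    using split_of_quasi_convex[OF qc] by metis
  show "quotient_growth_exponent G \<phi> p \<Gamma> < growth_exponent G \<phi> p"
  \<comment> \<open>A finite quotient has a bounded Poincare series, so the divergence argument
    cannot start there.\<close>
  proof (cases "finite cosets")
    case True
    obtain s where "0 < s" "ereal s \<le> growth_exponent G \<phi> p"
      using positive_growth by blast
    then have "0 < growth_exponent G \<phi> p"
      by (metis ereal_less(2) order.strict_trans2)
    then show ?thesis
      using quotient_growth_finite[OF True] by (simp add: quotient_growth_exponent_eq order.strict_trans1)
  next
    case False
    obtain \<delta> where "0 \<le> \<delta>" "exponential_growth_rate Q = ereal \<delta>"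
      "\<And>K. \<exists>F. finite F \<and> F \<subseteq> cosets \<and> K < (\<Sum>U\<in>F. exp (- \<delta> * nrm U))"
      using quotient_poincare_diverges[OF c False] by blast
    then show ?thesis
      using growth_exponent_gt by (simp add: quotient_growth_exponent_eq)
  qed
qed

end
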